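(* Let $m,n$ be positive integers with $n$ odd. Then the bar visibility number of the complete bipartite graph $K_{m,n}$ satisfies $b(K_{m,n})=\left\lceil \frac{mn+4}{2m+2n}\right\rceil$.
   Context: A bar is a horizontal line segment in the plane. A $t$-bar visibility representation of a graph $G$ assigns to each vertex of $G$ at most $t$ pairwise disjoint bars so that two vertices are adjacent if and only if some bar assigned to one of them sees some bar assigned to the other, where two bars see each other if there is an unobstructed vertical channel of positive width between them (an axis-parallel rectangle of positive width with bottom side in one bar, top side in the other, and interior meeting no other bar). The bar visibility number $b(G)$ is the least $t$ such that $G$ has a $t$-bar visibility representation.
   Formalization: The case m = n = 1 is excluded, because there the formula gives ⌈5/4⌉ = 2 while the single edge K_{1,1} has bar visibility number 1; all other positive m and odd n are covered. *)

theory Defs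
  imports Complex_Main "Graph_Theory.Graph_Theory"
begin

definition is_bar :: "(real \<times> real) set \<Rightarrow> bool" where
  "is_bar B \<longleftrightarrow> (\<exists>l r y. l < r \<and> B = {l..r} \<times> {y})"

text \<open>The channel is the rectangle with horizontal extent from \<open>a\<close> to \<open>b\<close>, bottom side at height
  \<open>c\<close> in the bar \<open>B\<close> and top side at height \<open>d\<close> in the bar \<open>B'\<close>.\<close>

definition channel :: "(real \<times> real) set set \<Rightarrow> (real \<times> real) set \<Rightarrow> (real \<times> real) set \<Rightarrow> bool" where
  "channel \<B> B B' \<longleftrightarrow> (\<exists>a b c d. a < b \<and> c < d \<and>
     {a..b} \<times> {c} \<subseteq> B \<and> {a..b} \<times> {d} \<subseteq> B' \<and>
     (\<forall>B'' \<in> \<B> - {B, B'}. ({a<..<b} \<times> {c<..<d}) \<inter> B'' = {}))"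

definition sees :: "(real \<times> real) set set \<Rightarrow> (real \<times> real) set \<Rightarrow> (real \<times> real) set \<Rightarrow> bool" where
  "sees \<B> B B' \<longleftrightarrow> channel \<B> B B' \<or> channel \<B> B' B"

text \<open>Disjointness is required of all bars of the representation, also of bars assigned to different
  vertices: if the bars of nonadjacent vertices were allowed to coincide, then every complete
  bipartite graph would have a representation with one bar per vertex.
  Since bars are nonempty, this also prevents two vertices from sharing a bar.\<close>

definition bar_visibility_rep ::
  "nat \<Rightarrow> ('a, 'b) pre_digraph \<Rightarrow> ('a \<Rightarrow> (real \<times> real) set set) \<Rightarrow> bool" where
  "bar_visibility_rep t G \<beta> \<longleftrightarrow>
     (\<forall>v \<in> verts G. finite (\<beta> v) \<and> card (\<beta> v) \<le> t \<and> (\<forall>B \<in> \<beta> v. is_bar B)) \<and>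
     (\<forall>u \<in> verts G. \<forall>v \<in> verts G. \<forall>B \<in> \<beta> u. \<forall>B' \<in> \<beta> v. (u, B) \<noteq> (v, B') \<longrightarrow> B \<inter> B' = {}) \<and>
     (\<forall>u \<in> verts G. \<forall>v \<in> verts G. u \<noteq> v \<longrightarrow>
        (u \<rightarrow>\<^bsub>G\<^esub> v \<longleftrightarrow> (\<exists>B \<in> \<beta> u. \<exists>B' \<in> \<beta> v. sees (\<Union>w \<in> verts G. \<beta> w) B B')))"

definition bar_visibility_number :: "('a, 'b) pre_digraph \<Rightarrow> nat" where
  "bar_visibility_number G = (LEAST t. \<exists>\<beta>. bar_visibility_rep t G \<beta>)"

text \<open>For \<open>m = n = 1\<close> the closed formula has the value 2, whereas the single edge has bar visibility
  number 1: the lower bound \<open>\<lceil>(m n + 4) / (2 m + 2 n)\<rceil>\<close> comes from the bound \<open>2 N - 4\<close>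
  on the number of edges of a bipartite planar graph, which needs \<open>N \<ge> 3\<close> vertices.\<close>

lemma bar_visibility_number_K11:
  assumes "complete_bipartite_digraph 1 1 G"
  shows "bar_visibility_number G = 1"
proof -
  from assms obtain U V where UV: "verts G = U \<union> V" "U \<inter> V = {}" "card U = 1" "card V = 1"
      "arcs_ends G = U \<times> V \<union> V \<times> U"
    unfolding complete_bipartite_digraph_def by auto
  then obtain u v where uv: "U = {u}" "V = {v}"
    by (auto simp: card_1_singleton_iff)
  then have G: "verts G = {u, v}" "u \<noteq> v" "u \<rightarrow>\<^bsub>G\<^esub> v" "v \<rightarrow>\<^bsub>G\<^esub> u"
    using UV by auto
  define P Q :: "(real \<times> real) set" where "P = {0..1} \<times> {0}" and "Q = {0..1} \<times> {1}"
  define \<beta> where "\<beta> w = (if w = u then {P} else {Q})" for w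
  have bars: "is_bar P" "is_bar Q"
    unfolding is_bar_def P_def Q_def by (intro exI conjI; (rule refl | simp))+
  have disj: "P \<inter> Q = {}"
    by (auto simp: P_def Q_def)
  have "channel {P, Q} P Q"
    unfolding channel_def
    by (rule exI[of _ 0], rule exI[of _ 1], rule exI[of _ 0], rule exI[of _ 1])
      (auto simp: P_def Q_def)
  then have "sees {P, Q} P Q" "sees {P, Q} Q P"
    by (auto simp: sees_def)
  moreover have "(\<Union>w \<in> verts G. \<beta> w) = {P, Q}"
    using G by (auto simp: \<beta>_def)
  ultimately have "bar_visibility_rep 1 G \<beta>"
    unfolding bar_visibility_rep_def using G bars disj by (auto simp: \<beta>_def)
  then have rep: "\<exists>\<beta>. bar_visibility_rep 1 G \<beta>"
    by blast
  have "\<not> bar_visibility_rep 0 G \<beta>'" for \<beta>'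
    using G unfolding bar_visibility_rep_def by auto
  then have "1 \<le> t" if "\<exists>\<beta>. bar_visibility_rep t G \<beta>" for t
    using that by (cases t) auto
  then show ?thesis
    unfolding bar_visibility_number_def using rep by (intro Least_equality) auto
qed

end

theory Submission
  imports Defs "HOL-Library.Multiset"
begin

text \<open>
  Lower bound. Sweep a vertical line from left to right over a representation with \<open>N\<close> bars and
  consider the word of the bars that it meets. The word changes by one letter at each of the \<open>2 N\<close>
  ends of bars, and a potential argument (two neighbouring letters of different sides are a seen pair,
  a change of sides in the word is worth half a pair) shows that at most \<open>2 N - 4\<close> pairs are seen
  when \<open>N \<ge> 3\<close>. This replaces Euler's formula.

  Upper bound. Conversely, every sequence of words in which contiguous segments are replaced by fresh
  letters is drawn by bars, so one only has to schedule words in which the two sides alternate. If one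
  side has at most \<open>2 t\<close> vertices, use words with two letters of this side around one letter of the other.
  Otherwise let \<open>n = 2 t + q\<close> and label a path of \<open>t n\<close> bars cyclically by the \<open>n\<close> vertices of one side.
  Each of the \<open>m\<close> other vertices gets one long bar that sees \<open>q + 2\<close> consecutive path bars; its remaining
  \<open>2 t - 2\<close> neighbours form \<open>t - 1\<close> pairs of consecutive labels, and each pair is served by a short bar
  between two neighbouring path bars. The long bars are the faces of a planar map on the path bars: two
  faces around a segment of the path form a pillow, consecutive pillows share two path bars, and if
  both \<open>m\<close> and \<open>n\<close> are odd, the last three faces are those of a theta graph.
\<close>

section \<open>Words and moves\<close>

text \<open>The bound \<open>m * n + 4 <= 2 * t * (m + n)\<close> is \<open>2 * N - 4\<close> for
  \<open>N = t * (m + n)\<close> bars, so the drawing has almost nothing to waste. With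
  \<open>n = 2 * t + q\<close> it reads \<open>m * q + 4 <= 2 * t * n\<close>. For
  \<open>m = 2 * k\<close> this is \<open>q * k + 2 <= t * n\<close>, and \<open>q * k + 2\<close>
  is exactly the number of path bars that \<open>k\<close> pillows of \<open>q + 2\<close> bars
  occupy when neighbours share two. For \<open>m = 2 * k + 3\<close> and
  \<open>q + 1 = 2 * p\<close> it is \<open>2 * (q * k + 3 * p) + 1 <= 2 * t * n\<close>; parity
  turns this into \<open>q * k + 3 * p + 1 <= t * n\<close>, the length of a chain that ends in a
  theta graph. The bars of one vertex then serve \<open>(q + 2) + 2 * (t - 1) = n\<close>
  neighbours. Since all pairs of opposite sides are edges, a sighting is harmful only within one
  side.\<close>

fun consec :: "'a list \<Rightarrow> ('a \<times> 'a) set" where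
  "consec (x # y # zs) = insert (x, y) (consec (y # zs))"
| "consec _ = {}"

lemma consec_append_Cons2:
  "consec (xs @ x # y # zs) = insert (x, y) (consec (xs @ [x]) \<union> consec (y # zs))"
  by (induction xs rule: induct_list012) auto

lemma consec_rev: "consec (rev xs) = (consec xs)\<inverse>"
proof (induction xs rule: induct_list012)
  case (3 x y zs)
  have "consec (rev (x # y # zs)) = consec (rev zs @ y # x # [])"
    by simp
  also have "\<dots> = insert (y, x) (consec (rev (y # zs)))"
    by (subst consec_append_Cons2) simp
  finally show ?case
    using 3 by auto
qed auto

definition adj :: "('u + 'v) list \<Rightarrow> ('u \<times> 'v) set" where
  "adj w = {(u, v). (Inl u, Inr v) \<in> consec w \<union> (consec w)\<inverse>}"

lemma adj_rev: "adj (rev w) = adj w"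
  by (auto simp: adj_def consec_rev)

lemma adj_simps:
  "adj [] = {}" "adj [x] = {}"
  "adj (Inl u # Inr v # zs) = insert (u, v) (adj (Inr v # zs))"
  "adj (Inr v # Inl u # zs) = insert (u, v) (adj (Inl u # zs))"
  "adj (xs @ Inl u # Inr v # zs) = insert (u, v) (adj (xs @ [Inl u]) \<union> adj (Inr v # zs))"
  "adj (xs @ Inr v # Inl u # zs) = insert (u, v) (adj (xs @ [Inr v]) \<union> adj (Inl u # zs))"
  by (auto simp: adj_def consec_append_Cons2)

definition opp :: "'u + 'v \<Rightarrow> 'u + 'v \<Rightarrow> bool" where
  "opp a b \<longleftrightarrow> isl a \<noteq> isl b"

lemma opp_simps [simp]:
  "opp (Inl u) (Inr v)" "opp (Inr v) (Inl u)" "\<not> opp (Inl u) (Inl u')" "\<not> opp (Inr v) (Inr v')"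
  by (auto simp: opp_def)

lemma opp_commute: "(\<lambda>a b. opp b a) = opp"
  by (auto simp: opp_def fun_eq_iff)

abbreviation alternating :: "('u + 'v) list \<Rightarrow> bool" where
  "alternating \<equiv> successively opp"

lemma successively_append_Cons2:
  "successively P (xs @ x # y # zs) \<longleftrightarrow>
    successively P (xs @ [x]) \<and> P x y \<and> successively P (y # zs)"
  by (auto simp: successively_append_iff)

text \<open>The multiset counts the letters that were created, that is, the bars of each vertex.\<close>

inductive game :: "('u + 'v) list \<Rightarrow> ('u + 'v) multiset \<Rightarrow> ('u \<times> 'v) set \<Rightarrow> bool" where
  start: "game [] {#} {}"
| move: "game (xs @ as @ ys) M S \<Longrightarrow> alternating (xs @ bs @ ys) \<Longrightarrow>
    game (xs @ bs @ ys) (M + mset bs) (S \<union> adj (xs @ bs @ ys))"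

lemma game_alternating: "game w M S \<Longrightarrow> alternating w"
  by (induction rule: game.induct) auto

lemma game_adj: "game w M S \<Longrightarrow> adj w \<subseteq> S"
  by (induction rule: game.induct) (auto simp: adj_simps)

lemma game_rev: "game w M S \<Longrightarrow> game (rev w) M S"
proof (induction rule: game.induct)
  case (move xs as ys M S bs)
  have "alternating (rev ys @ rev bs @ rev xs)"
    using move.hyps(2) successively_rev[of opp "xs @ bs @ ys"] unfolding opp_commute by simp
  then have "game (rev ys @ rev bs @ rev xs) (M + mset (rev bs)) (S \<union> adj (rev ys @ rev bs @ rev xs))"
    using move.IH by (intro game.move[of _ "rev as"]) auto
  moreover have "adj (rev ys @ rev bs @ rev xs) = adj (xs @ bs @ ys)"
    using adj_rev[of "xs @ bs @ ys"] by simp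
  ultimately show ?case
    by simp
qed (simp add: game.start)

text \<open>A subset is enough: further sightings recorded by \<open>game\<close> join opposite
  sides and are edges anyway, so only the wanted pairs are tracked.\<close>

definition reach :: "('u + 'v) list \<Rightarrow> ('u + 'v) multiset \<Rightarrow> ('u \<times> 'v) set \<Rightarrow> bool" where
  "reach w M R \<longleftrightarrow> (\<exists>S. game w M S \<and> R \<subseteq> S)"

lemma reach_mono: "reach w M R \<Longrightarrow> R' \<subseteq> R \<Longrightarrow> reach w M R'"
  by (auto simp: reach_def)

lemma reach_mono': "reach w M R \<Longrightarrow> M' = M \<Longrightarrow> R' \<subseteq> R \<Longrightarrow> reach w M' R'"
  by (auto simp: reach_def)

lemma reach_adj: "reach w M R \<Longrightarrow> reach w M (R \<union> adj w)"
  using game_adj by (fastforce simp: reach_def)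

lemma reach_rev: "reach w M R \<Longrightarrow> reach (rev w) M R"
  by (auto simp: reach_def dest: game_rev)

lemma reach_alternating: "reach w M R \<Longrightarrow> alternating w"
  by (auto simp: reach_def dest: game_alternating)

lemma reach_start: "reach [] {#} {}"
  by (auto simp: reach_def intro: game.start)

lemma reach_move:
  assumes "reach (xs @ as @ ys) M R" "alternating (xs @ bs @ ys)"
  shows "reach (xs @ bs @ ys) (M + mset bs) (R \<union> adj (xs @ bs @ ys))"
proof -
  obtain S where S: "game (xs @ as @ ys) M S" "R \<subseteq> S"
    using assms by (auto simp: reach_def)
  show ?thesis
    unfolding reach_def using game.move[OF S(1) assms(2)] S(2) by blast
qed

lemma reach_move':
  assumes "reach w M R" "w = xs @ as @ ys" "w' = xs @ bs @ ys" "alternating w'"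
    "M' = M + mset bs" "R' \<subseteq> R \<union> adj w \<union> adj w'"
  shows "reach w' M' R'"
  using reach_mono[OF reach_move[of xs as ys M "R \<union> adj w" bs]] reach_adj[OF assms(1)] assms by auto

definition star :: "'u \<Rightarrow> 'v set \<Rightarrow> ('u \<times> 'v) set" where
  "star u X = {u} \<times> X"

lemma star_simps [simp]:
  "star u {} = {}" "star u (insert v X) = insert (u, v) (star u X)"
  "star u (X \<union> Y) = star u X \<union> star u Y"
  by (auto simp: star_def)

text \<open>A region \<open>x a y\<close> of the word is played, in any context, until it is \<open>x b y\<close>; the bars \<open>x\<close> and \<open>y\<close> persist,
  \<open>K\<close> collects the new bars and \<open>Q\<close> the pairs that have been seen at the end.\<close>

definition fill :: "'v \<Rightarrow> 'v \<Rightarrow> 'u \<Rightarrow> ('u + 'v) multiset \<Rightarrow> ('u \<times> 'v) set \<Rightarrow> 'u \<Rightarrow> bool" where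
  "fill x y a K Q b \<longleftrightarrow> (\<forall>xs ys M R. reach (xs @ [Inr x, Inl a, Inr y] @ ys) M R \<longrightarrow>
     reach (xs @ [Inr x, Inl b, Inr y] @ ys) (M + K) (R \<union> Q))"

lemma fillD:
  "fill x y a K Q b \<Longrightarrow> reach (xs @ [Inr x, Inl a, Inr y] @ ys) M R \<Longrightarrow>
     reach (xs @ [Inr x, Inl b, Inr y] @ ys) (M + K) (R \<union> Q)"
  unfolding fill_def by blast

lemma fill_sym:
  assumes "fill x y a K Q b"
  shows "fill y x a K Q b"
  unfolding fill_def
proof (intro allI impI)
  fix xs ys M R
  assume "reach (xs @ [Inr y, Inl a, Inr x] @ ys) M R"
  then have "reach (rev ys @ [Inr x, Inl a, Inr y] @ rev xs) M R"
    by (drule_tac reach_rev) simp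
  from reach_rev[OF fillD[OF assms this]]
  show "reach (xs @ [Inr y, Inl b, Inr x] @ ys) (M + K) (R \<union> Q)"
    by simp
qed

lemma fill_refl: "fill x y a {#} (star a {x, y}) a"
  unfolding fill_def
proof (intro allI impI)
  fix xs ys M R
  assume "reach (xs @ [Inr x, Inl a, Inr y] @ ys) M R"
  from reach_adj[OF this]
  show "reach (xs @ [Inr x, Inl a, Inr y] @ ys) (M + {#}) (R \<union> star a {x, y})"
    by (rule reach_mono') (auto simp: adj_simps)
qed

lemma fill_trans:
  assumes "fill x y a K Q b" "fill x y b K' Q' c"
  shows "fill x y a (K + K') (Q \<union> Q') c"
  unfolding fill_def
proof (intro allI impI)
  fix xs ys M R
  assume "reach (xs @ [Inr x, Inl a, Inr y] @ ys) M R"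
  from fillD[OF assms(2) fillD[OF assms(1) this]]
  show "reach (xs @ [Inr x, Inl c, Inr y] @ ys) (M + (K + K')) (R \<union> (Q \<union> Q'))"
    by (simp add: add.assoc Un_assoc)
qed

lemma fill_subst: "fill x y a {#Inl b#} {} b"
  unfolding fill_def
proof (intro allI impI)
  fix xs ys M R
  assume *: "reach (xs @ [Inr x, Inl a, Inr y] @ ys) M R"
  show "reach (xs @ [Inr x, Inl b, Inr y] @ ys) (M + {#Inl b#}) (R \<union> {})"
    by (rule reach_move'[OF *, where xs = "xs @ [Inr x]" and as = "[Inl a]" and ys = "Inr y # ys"
          and bs = "[Inl b]"]) (use reach_alternating[OF *] in \<open>auto simp: successively_append_Cons2\<close>)
qed

text \<open>As \<open>fill\<close>, but starting when the neighbours \<open>x\<close> and \<open>y\<close> of the path come to face each other; nothing at all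
  may be inserted between them, and otherwise the first inserted bar is counted in \<open>K\<close>.\<close>

definition estep :: "'v \<Rightarrow> 'v \<Rightarrow> ('u + 'v) multiset \<Rightarrow> ('u \<times> 'v) set \<Rightarrow> bool" where
  "estep x y K Q \<longleftrightarrow> K = {#} \<and> Q = {} \<or> (\<exists>a b K0. K = add_mset (Inl a) K0 \<and> fill x y a K0 Q b)"

lemma estep_sym: "estep x y K Q \<Longrightarrow> estep y x K Q"
  unfolding estep_def by (metis fill_sym)

text \<open>If bars have already been played between \<open>x\<close> and \<open>y\<close>, the last
  of them is replaced by \<open>a\<close>; otherwise \<open>a\<close> becomes the first inserted
  bar. So the activities at one path edge can be queued.\<close>

lemma estep_fill:
  assumes "estep x y K Q" "fill x y a K' Q' b"
  shows "estep x y (K + add_mset (Inl a) K') (Q \<union> Q')"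
  using assms(1) unfolding estep_def
proof (elim disjE exE conjE)
  fix a1 b1 K0 assume K: "K = add_mset (Inl a1) K0" and *: "fill x y a1 K0 Q b1"
  have "fill x y a1 (K0 + ({#Inl a#} + K')) (Q \<union> ({} \<union> Q')) b"
    by (intro fill_trans[OF *] fill_trans[OF fill_subst] assms(2))
  then show "K + add_mset (Inl a) K' = {#} \<and> Q \<union> Q' = {} \<or>
      (\<exists>a1 b K0. K + add_mset (Inl a) K' = add_mset (Inl a1) K0 \<and> fill x y a1 K0 (Q \<union> Q') b)"
    using K by (intro disjI2 exI conjI) auto
qed (use assms(2) in auto)

lemma estep_list: "estep x y (mset (map Inl D)) (\<Union>d\<in>set D. star d {x, y})"
proof (induction D rule: rev_induct)
  case (snoc d D)
  have "estep x y (mset (map Inl D) + add_mset (Inl d) {#})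
      ((\<Union>d\<in>set D. star d {x, y}) \<union> star d {x, y})"
    by (rule estep_fill[OF snoc fill_refl])
  then show ?case
    by (simp add: Un_commute)
qed (simp add: estep_def)

text \<open>With nothing to insert, \<open>z'\<close> replaces \<open>z\<close> in one move.
  Otherwise \<open>z'\<close> is created next to \<open>z\<close>, the space between them is played
  out, and \<open>z\<close> is deleted together with the last inserted bar. In the course of this
  both \<open>a\<close> and \<open>b\<close> meet both path bars.\<close>

lemma run_step:
  assumes "estep z z' K Q" "reach (xs @ [Inl a, Inr z, Inl b] @ ys) M R"
  shows "reach (xs @ [Inl a, Inr z', Inl b] @ ys) (M + (K + {#Inr z'#}))
    (R \<union> Q \<union> star a {z, z'} \<union> star b {z, z'})"
  using assms(1) unfolding estep_def
proof (elim disjE exE conjE)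
  note alt = reach_alternating[OF assms(2)]
  show ?thesis if "K = {#}" "Q = {}"
    by (rule reach_move'[OF assms(2), where xs = "xs @ [Inl a]" and as = "[Inr z]" and ys = "Inl b # ys"
          and bs = "[Inr z']"])
      (use that alt in \<open>auto simp: successively_append_Cons2 adj_simps\<close>)
  fix a1 b1 K0 assume K: "K = add_mset (Inl a1) K0" and *: "fill z z' a1 K0 Q b1"
  have 1: "reach ((xs @ [Inl a]) @ [Inr z, Inl a1, Inr z'] @ Inl b # ys) (M + {#Inl a1, Inr z'#})
      (R \<union> star a {z} \<union> star b {z, z'})"
    by (rule reach_move'[OF assms(2), where xs = "xs @ [Inl a, Inr z]" and as = "[]" and ys = "Inl b # ys"
          and bs = "[Inl a1, Inr z']"])
      (use alt in \<open>auto simp: successively_append_Cons2 adj_simps\<close>)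
  note 2 = fillD[OF * 1]
  show ?thesis
    by (rule reach_move'[OF 2, where xs = "xs @ [Inl a]" and as = "[Inr z, Inl b1]"
          and ys = "[Inr z', Inl b] @ ys" and bs = "[]"])
      (use K alt in \<open>auto simp: successively_append_Cons2 adj_simps\<close>)
qed

lemma run:
  assumes "j \<le> k" "\<And>i. j \<le> i \<Longrightarrow> i < k \<Longrightarrow> estep (w i) (w (Suc i)) (K i) (Q i)"
    "reach (xs @ [Inl a, Inr (w j), Inl b] @ ys) M R"
  shows "reach (xs @ [Inl a, Inr (w k), Inl b] @ ys) (M + (\<Sum>i\<in>{j..<k}. K i) + (\<Sum>i\<in>{j<..k}. {#Inr (w i)#}))
    (R \<union> (\<Union>i\<in>{j..<k}. Q i) \<union> star a (w ` {j..k}) \<union> star b (w ` {j..k}))"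
  using assms
proof (induction k rule: dec_induct)
  case base
  show ?case
    by (rule reach_mono'[OF reach_adj[OF base(2)]]) (auto simp: adj_simps)
next
  case (step k)
  from run_step[OF step.prems(1)[of k] step.IH] step
  have "reach (xs @ [Inl a, Inr (w (Suc k)), Inl b] @ ys)
      (M + (\<Sum>i\<in>{j..<k}. K i) + (\<Sum>i\<in>{j<..k}. {#Inr (w i)#}) + (K k + {#Inr (w (Suc k))#}))
      (R \<union> (\<Union>i\<in>{j..<k}. Q i) \<union> star a (w ` {j..k}) \<union> star b (w ` {j..k}) \<union> Q k
        \<union> star a {w k, w (Suc k)} \<union> star b {w k, w (Suc k)})"
    by simp
  moreover have "{j..<Suc k} = insert k {j..<k}" "{j<..Suc k} = insert (Suc k) {j<..k}"
      "{j..Suc k} = insert (Suc k) {j..k}"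
    using step(1,2) by auto
  ultimately show ?case
    by - (rule reach_mono', assumption, (simp add: add_ac), auto)
qed

text \<open>The path is traversed from its far end, which \<open>estep_sym\<close> permits. Only the
  start differs: \<open>w k\<close> is already counted, so the new bars are those from
  \<open>j\<close> to \<open>k - 1\<close>.\<close>

lemma run_down:
  assumes "j \<le> k" "\<And>i. j \<le> i \<Longrightarrow> i < k \<Longrightarrow> estep (w i) (w (Suc i)) (K i) (Q i)"
    "reach (xs @ [Inl a, Inr (w k), Inl b] @ ys) M R"
  shows "reach (xs @ [Inl a, Inr (w j), Inl b] @ ys) (M + (\<Sum>i\<in>{j..<k}. K i) + (\<Sum>i\<in>{j..<k}. {#Inr (w i)#}))
    (R \<union> (\<Union>i\<in>{j..<k}. Q i) \<union> star a (w ` {j..k}) \<union> star b (w ` {j..k}))"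
  using assms
proof (induction j rule: inc_induct)
  case base
  show ?case
    by (rule reach_mono'[OF reach_adj[OF base(2)]]) (auto simp: adj_simps)
next
  case (step j)
  have "reach (xs @ [Inl a, Inr (w (Suc j)), Inl b] @ ys)
      (M + (\<Sum>i\<in>{Suc j..<k}. K i) + (\<Sum>i\<in>{Suc j..<k}. {#Inr (w i)#}))
      (R \<union> (\<Union>i\<in>{Suc j..<k}. Q i) \<union> star a (w ` {Suc j..k}) \<union> star b (w ` {Suc j..k}))"
    using step by simp
  from run_step[OF estep_sym[OF step.prems(1)[of j]] this] step
  have "reach (xs @ [Inl a, Inr (w j), Inl b] @ ys)
      (M + (\<Sum>i\<in>{Suc j..<k}. K i) + (\<Sum>i\<in>{Suc j..<k}. {#Inr (w i)#}) + (K j + {#Inr (w j)#}))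
      (R \<union> (\<Union>i\<in>{Suc j..<k}. Q i) \<union> star a (w ` {Suc j..k}) \<union> star b (w ` {Suc j..k}) \<union> Q j
        \<union> star a {w (Suc j), w j} \<union> star b {w (Suc j), w j})"
    by simp
  moreover have "{j..<k} = insert j {Suc j..<k}" "{j..k} = insert j {Suc j..k}"
    using step(1,2) by auto
  ultimately show ?case
    by - (rule reach_mono', assumption, (simp add: add_ac), auto)
qed

section \<open>Pillows and theta graphs\<close>

lemma estep_reach:
  assumes "estep z z' K Q" "reach (xs @ [Inr z, Inl a, Inr z'] @ ys) M R"
  shows "\<exists>b. reach (xs @ [Inr z, Inl b, Inr z'] @ ys) (M + K) (R \<union> Q)"
  using assms(1) unfolding estep_def
proof (elim disjE exE conjE)
  show ?thesis if "K = {#}" "Q = {}"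
    using that assms(2) by auto
  fix a1 b1 K0 assume K: "K = add_mset (Inl a1) K0" and *: "fill z z' a1 K0 Q b1"
  have "reach (xs @ [Inr z, Inl b1, Inr z'] @ ys) (M + ({#Inl a1#} + K0)) (R \<union> ({} \<union> Q))"
    by (rule fillD[OF fill_trans[OF fill_subst *] assms(2)])
  then show ?thesis
    using K by (intro exI[of _ b1]) simp
qed

text \<open>This opens a face: in contrast to \<open>run_step\<close>, the old bar \<open>z\<close>
  stays as the border of the region. If bars are played between \<open>z'\<close> and
  \<open>z\<close>, the bar \<open>b\<close> replaces the last of them.\<close>

lemma first_step:
  assumes "estep z z' K Q" "reach (xs @ [Inl a, Inr z] @ ys) M R"
  shows "reach (xs @ [Inl a, Inr z', Inl b, Inr z] @ ys) (M + K + {#Inr z', Inl b#})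
    (R \<union> Q \<union> star a {z, z'} \<union> star b {z, z'})"
  using assms(1) unfolding estep_def
proof (elim disjE exE conjE)
  note alt = reach_alternating[OF assms(2)]
  show ?thesis if "K = {#}" "Q = {}"
    by (rule reach_move'[OF assms(2), where xs = "xs @ [Inl a]" and as = "[]" and ys = "Inr z # ys"
          and bs = "[Inr z', Inl b]"])
      (use that alt in \<open>auto simp: successively_append_Cons2 adj_simps\<close>)
  fix a1 b1 K0 assume K: "K = add_mset (Inl a1) K0" and *: "fill z z' a1 K0 Q b1"
  have 1: "reach ((xs @ [Inl a]) @ [Inr z', Inl a1, Inr z] @ ys) (M + {#Inr z', Inl a1#})
      (R \<union> star a {z, z'})"
    by (rule reach_move'[OF assms(2), where xs = "xs @ [Inl a]" and as = "[]" and ys = "Inr z # ys"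
          and bs = "[Inr z', Inl a1]"])
      (use alt in \<open>auto simp: successively_append_Cons2 adj_simps\<close>)
  note 2 = fillD[OF fill_sym[OF *] 1]
  show ?thesis
    by (rule reach_move'[OF 2, where xs = "xs @ [Inl a, Inr z']" and as = "[Inl b1]"
          and ys = "Inr z # ys" and bs = "[Inl b]"])
      (use K alt in \<open>auto simp: successively_append_Cons2 adj_simps\<close>)
qed

text \<open>The faces \<open>a\<close> and \<open>b\<close> both see the whole segment \<open>s..e\<close> of the path: between the words \<open>w s, a, w (s + 1)\<close> and
  \<open>w s, b, w (s + 1)\<close>, the letter \<open>z\<close> in \<open>w s, a, z, b, w (s + 1)\<close> runs along the path.\<close>

lemma pillow:
  fixes w :: "nat \<Rightarrow> 'v" and K :: "nat \<Rightarrow> ('u + 'v) multiset"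
  assumes "s + 2 \<le> e" "\<And>i. s < i \<Longrightarrow> i < e \<Longrightarrow> estep (w i) (w (Suc i)) (K i) (Q i)"
  shows "fill (w s) (w (Suc s)) a
    ({#Inl b#} + (\<Sum>i\<in>{s<..<e}. K i) + (\<Sum>i\<in>{Suc s<..e}. {#Inr (w i)#}))
    ((\<Union>i\<in>{s<..<e}. Q i) \<union> star a (w ` {s..e}) \<union> star b (w ` {s..e})) b"
  unfolding fill_def
proof (intro allI impI)
  fix xs ys M R
  assume *: "reach (xs @ [Inr (w s), Inl a, Inr (w (Suc s))] @ ys) M R"
  then have 0: "reach ((xs @ [Inr (w s)]) @ [Inl a, Inr (w (Suc s))] @ ys) M (R \<union> star a {w s})"
    using reach_mono[OF reach_adj[OF *], of "R \<union> star a {w s}"]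
    by (simp add: adj_simps subset_iff)
  have "reach ((xs @ [Inr (w s)]) @ [Inl a, Inr (w (Suc (Suc s))), Inl b] @ Inr (w (Suc s)) # ys)
      (M + K (Suc s) + {#Inr (w (Suc (Suc s))), Inl b#})
      (R \<union> star a {w s} \<union> Q (Suc s) \<union> star a {w (Suc s), w (Suc (Suc s))}
        \<union> star b {w (Suc s), w (Suc (Suc s))})"
    using first_step[OF assms(2)[of "Suc s"] 0, of b] assms(1) by simp
  note 1 = run[where w = w and K = K and Q = Q and j = "Suc (Suc s)" and k = e, OF _ _ this]
  have 1: "reach ((xs @ [Inr (w s)]) @ [Inl a, Inr (w e), Inl b] @ Inr (w (Suc s)) # ys)
      (M + K (Suc s) + {#Inr (w (Suc (Suc s))), Inl b#} + (\<Sum>i\<in>{Suc (Suc s)..<e}. K i)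
        + (\<Sum>i\<in>{Suc (Suc s)<..e}. {#Inr (w i)#}))
      (R \<union> star a {w s} \<union> Q (Suc s) \<union> star a {w (Suc s), w (Suc (Suc s))}
        \<union> star b {w (Suc s), w (Suc (Suc s))} \<union> (\<Union>i\<in>{Suc (Suc s)..<e}. Q i)
        \<union> star a (w ` {Suc (Suc s)..e}) \<union> star b (w ` {Suc (Suc s)..e}))"
    by (rule 1) (use assms in auto)
  have sets: "{s<..<e} = insert (Suc s) {Suc (Suc s)..<e}" "{Suc s<..e} = insert (Suc (Suc s)) {Suc (Suc s)<..e}"
      "{s..e} = insert s (insert (Suc s) {Suc (Suc s)..e})"
    using assms(1) by auto
  have sums: "(\<Sum>i\<in>{s<..<e}. K i) = K (Suc s) + (\<Sum>i\<in>{Suc (Suc s)..<e}. K i)"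
      "(\<Sum>i\<in>{Suc s<..e}. {#Inr (w i) :: 'u + 'v#}) =
        {#Inr (w (Suc (Suc s)))#} + (\<Sum>i\<in>{Suc (Suc s)<..e}. {#Inr (w i)#})"
    unfolding sets by (subst sum.insert; auto)+
  show "reach (xs @ [Inr (w s), Inl b, Inr (w (Suc s))] @ ys)
      (M + ({#Inl b#} + (\<Sum>i\<in>{s<..<e}. K i) + (\<Sum>i\<in>{Suc s<..e}. {#Inr (w i)#})))
      (R \<union> ((\<Union>i\<in>{s<..<e}. Q i) \<union> star a (w ` {s..e}) \<union> star b (w ` {s..e})))"
  \<comment> \<open>Deleting \<open>a\<close> and \<open>w e\<close> brings \<open>b\<close> next to
    \<open>w s\<close>, the only bar of the segment that \<open>b\<close> has not met yet.\<close>
  proof (rule reach_move'[OF 1, where xs = "xs @ [Inr (w s)]" and as = "[Inl a, Inr (w e)]"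
          and ys = "[Inl b, Inr (w (Suc s))] @ ys" and bs = "[]"])
    show "alternating (xs @ [Inr (w s), Inl b, Inr (w (Suc s))] @ ys)"
      using reach_alternating[OF *] by (simp add: successively_append_Cons2)
      show "M + ({#Inl b#} + (\<Sum>i\<in>{s<..<e}. K i) + (\<Sum>i\<in>{Suc s<..e}. {#Inr (w i)#})) =
        M + K (Suc s) + {#Inr (w (Suc (Suc s))), Inl b#} + (\<Sum>i\<in>{Suc (Suc s)..<e}. K i)
        + (\<Sum>i\<in>{Suc (Suc s)<..e}. {#Inr (w i)#}) + mset []"
      unfolding sums by simp
  qed (simp_all add: sets adj_simps, blast)
qed

text \<open>The theta graph is the path \<open>s..e\<close> with the chords from \<open>s\<close> to \<open>s + 2 p\<close> and from \<open>s + p\<close> to \<open>e\<close>. The middle of the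
  play is \<open>w s, a, z, c, z', b, w (s + 1)\<close>, where \<open>z\<close> runs from \<open>s + p\<close> up to \<open>s + 2 p\<close> and \<open>z'\<close> from \<open>e\<close> down to \<open>s + 2 p + 1\<close>.\<close>

lemma theta:
  fixes w :: "nat \<Rightarrow> 'v" and K :: "nat \<Rightarrow> ('u + 'v) multiset"
  assumes "1 \<le> p" "s + 3 * p \<le> e" "\<And>i. s < i \<Longrightarrow> i < e \<Longrightarrow> estep (w i) (w (Suc i)) (K i) (Q i)"
  shows "fill (w s) (w (Suc s)) a
    ({#Inl b, Inl c#} + (\<Sum>i\<in>{s<..<e}. K i) + (\<Sum>i\<in>{Suc s<..e}. {#Inr (w i)#}))
    ((\<Union>i\<in>{s<..<e}. Q i) \<union> star a (w ` {s..s + 2 * p}) \<union> star b (w ` ({s..s + p} \<union> {s + 2 * p..e}))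
      \<union> star c (w ` {s + p..e})) b"
  unfolding fill_def
proof (intro allI impI)
  fix xs ys M R
  assume *: "reach (xs @ [Inr (w s), Inl a, Inr (w (Suc s))] @ ys) M R"
  note alt = reach_alternating[OF *]
  have 0: "reach ((xs @ [Inr (w s)]) @ [Inl a, Inr (w (Suc s))] @ ys) M (R \<union> star a {w s})"
    using reach_mono[OF reach_adj[OF *], of "R \<union> star a {w s}"]
    by (simp add: adj_simps subset_iff)
  define r where "r = s + 2 * p"
  have r: "Suc s < r" "r < e"
    using assms(1,2) by (auto simp: r_def)
  have 1: "reach ((xs @ [Inr (w s)]) @ [Inl a, Inr (w r), Inl c] @ [Inr (w e), Inl b, Inr (w (Suc s))] @ ys)
      (M + {#Inl b, Inl c#} + (\<Sum>i\<in>{s<..<r}. K i) + (\<Sum>i\<in>{Suc s<..r}. {#Inr (w i)#}) + {#Inr (w e)#})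
      (R \<union> (\<Union>i\<in>{s<..<r}. Q i) \<union> star a (w ` {s..r}) \<union> star b (w ` ({s<..s + p} \<union> {e}))
        \<union> star c (w ` ({s + p..r} \<union> {e})))" (is "reach ?W ?M ?R")
  \<comment> \<open>For \<open>p = 1\<close> the position \<open>s + p\<close> is the border bar
    \<open>w (s + 1)\<close> itself, so there is no first run between \<open>a\<close> and
    \<open>b\<close>; the first step creates \<open>c\<close>, and \<open>b\<close> is inserted
    afterwards.\<close>
  proof (cases "p = 1")
    case True
    then have p: "s + p = Suc s" "r = Suc (Suc s)" "{s<..<Suc (Suc s)} = {Suc s}"
        "{Suc s<..Suc (Suc s)} = {Suc (Suc s)}" "{s<..Suc s} = {Suc s}"
        "{s..Suc (Suc s)} = {s, Suc s, Suc (Suc s)}" "{Suc s..Suc (Suc s)} = {Suc s, Suc (Suc s)}"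
      by (auto simp: r_def)
    have 1: "reach ((xs @ [Inr (w s)]) @ [Inl a, Inr (w (Suc (Suc s))), Inl c, Inr (w (Suc s))] @ ys)
        (M + K (Suc s) + {#Inr (w (Suc (Suc s))), Inl c#})
        (R \<union> star a {w s} \<union> Q (Suc s) \<union> star a {w (Suc s), w (Suc (Suc s))}
          \<union> star c {w (Suc s), w (Suc (Suc s))})"
      using first_step[OF assms(3)[of "Suc s"] 0, of c] assms(1,2) r by simp
    show ?thesis
      by (rule reach_move'[OF 1, where xs = "xs @ [Inr (w s), Inl a, Inr (w r), Inl c]" and as = "[]"
          and ys = "Inr (w (Suc s)) # ys" and bs = "[Inr (w e), Inl b]"])
        (use p alt in \<open>simp_all add: successively_append_Cons2 adj_simps, blast\<close>)
  next
    case False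
    then have p: "2 \<le> p"
      using assms(1) by simp
    define h where "h = s + p"
    have h: "Suc (Suc s) \<le> h" "h < r"
      using p by (auto simp: h_def r_def)
    have "reach ((xs @ [Inr (w s)]) @ [Inl a, Inr (w (Suc (Suc s))), Inl b] @ Inr (w (Suc s)) # ys)
        (M + K (Suc s) + {#Inr (w (Suc (Suc s))), Inl b#})
        (R \<union> star a {w s} \<union> Q (Suc s) \<union> star a {w (Suc s), w (Suc (Suc s))}
          \<union> star b {w (Suc s), w (Suc (Suc s))})"
      using first_step[OF assms(3)[of "Suc s"] 0, of b] h r by simp
    note 1 = run[where w = w and K = K and Q = Q and j = "Suc (Suc s)" and k = h, OF _ _ this]
    have 1: "reach ((xs @ [Inr (w s)]) @ [Inl a, Inr (w h), Inl b] @ Inr (w (Suc s)) # ys)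
        (M + K (Suc s) + {#Inr (w (Suc (Suc s))), Inl b#} + (\<Sum>i\<in>{Suc (Suc s)..<h}. K i)
          + (\<Sum>i\<in>{Suc (Suc s)<..h}. {#Inr (w i)#}))
        (R \<union> star a {w s} \<union> Q (Suc s) \<union> star a {w (Suc s), w (Suc (Suc s))}
          \<union> star b {w (Suc s), w (Suc (Suc s))} \<union> (\<Union>i\<in>{Suc (Suc s)..<h}. Q i)
          \<union> star a (w ` {Suc (Suc s)..h}) \<union> star b (w ` {Suc (Suc s)..h}))"
      by (rule 1) (use assms h r in auto)
    have sets: "{s<..<h} = insert (Suc s) {Suc (Suc s)..<h}" "{Suc s<..h} = insert (Suc (Suc s)) {Suc (Suc s)<..h}"
      "{s<..h} = insert (Suc s) {Suc (Suc s)..h}" "{s..h} = insert s (insert (Suc s) {Suc (Suc s)..h})"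
      using h by auto
    have sums: "(\<Sum>i\<in>{s<..<h}. K i) = K (Suc s) + (\<Sum>i\<in>{Suc (Suc s)..<h}. K i)"
        "(\<Sum>i\<in>{Suc s<..h}. {#Inr (w i) :: 'u + 'v#}) =
          {#Inr (w (Suc (Suc s)))#} + (\<Sum>i\<in>{Suc (Suc s)<..h}. {#Inr (w i)#})"
      unfolding sets by (subst sum.insert; auto)+
    have 2: "reach ((xs @ [Inr (w s)]) @ [Inl a, Inr (w h), Inl c] @ [Inr (w e), Inl b, Inr (w (Suc s))] @ ys)
        (M + {#Inl b, Inl c#} + (\<Sum>i\<in>{s<..<h}. K i) + (\<Sum>i\<in>{Suc s<..h}. {#Inr (w i)#}) + {#Inr (w e)#})
        (R \<union> (\<Union>i\<in>{s<..<h}. Q i) \<union> star a (w ` {s..h}) \<union> star b (w ` ({s<..h} \<union> {e}))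
          \<union> star c (w ` {h, e}))"
      by (rule reach_move'[OF 1, where xs = "xs @ [Inr (w s), Inl a, Inr (w h)]" and as = "[]"
          and ys = "[Inl b, Inr (w (Suc s))] @ ys" and bs = "[Inl c, Inr (w e)]"])
        (use h r alt in \<open>simp_all add: sets sums successively_append_Cons2 adj_simps, blast\<close>)
    have sets: "{s<..<r} = {s<..<h} \<union> {h..<r}" "{Suc s<..r} = {Suc s<..h} \<union> {h<..r}"
        "{s..r} = {s..h} \<union> {h..r}"
      using h by auto
    have sums: "(\<Sum>i\<in>{s<..<r}. K i) = (\<Sum>i\<in>{s<..<h}. K i) + (\<Sum>i\<in>{h..<r}. K i)"
        "(\<Sum>i\<in>{Suc s<..r}. {#Inr (w i) :: 'u + 'v#}) =
          (\<Sum>i\<in>{Suc s<..h}. {#Inr (w i)#}) + (\<Sum>i\<in>{h<..r}. {#Inr (w i)#})"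
      unfolding sets by (subst sum.union_disjoint; auto)+
    have "h \<le> r" "\<And>i. h \<le> i \<Longrightarrow> i < r \<Longrightarrow> estep (w i) (w (Suc i)) (K i) (Q i)"
      using h r assms(3) by auto
    note 3 = run[OF this 2]
    show ?thesis
    proof (rule reach_mono'[OF 3])
      show "?R \<subseteq> R \<union> (\<Union>i\<in>{s<..<h}. Q i) \<union> star a (w ` {s..h}) \<union> star b (w ` ({s<..h} \<union> {e}))
          \<union> star c (w ` {h, e}) \<union> (\<Union>i\<in>{h..<r}. Q i) \<union> star a (w ` {h..r}) \<union> star c (w ` {h..r})"
        by (simp add: sets image_Un flip: h_def) blast
    qed (assumption | simp only: sums add_ac)+
  qed
  then have "reach ((xs @ [Inr (w s), Inl a, Inr (w r)]) @ [Inl c, Inr (w e), Inl b] @ Inr (w (Suc s)) # ys) ?M ?R"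
    by simp
  moreover have "Suc r \<le> e" "\<And>i. Suc r \<le> i \<Longrightarrow> i < e \<Longrightarrow> estep (w i) (w (Suc i)) (K i) (Q i)"
    using r assms(3) by auto
  ultimately have "reach ((xs @ [Inr (w s), Inl a, Inr (w r)]) @ [Inl c, Inr (w (Suc r)), Inl b] @ Inr (w (Suc s)) # ys)
      (?M + (\<Sum>i\<in>{Suc r..<e}. K i) + (\<Sum>i\<in>{Suc r..<e}. {#Inr (w i)#}))
      (?R \<union> (\<Union>i\<in>{Suc r..<e}. Q i) \<union> star c (w ` {Suc r..e}) \<union> star b (w ` {Suc r..e}))"
    by (intro run_down)
  then have 2: "reach ((xs @ [Inr (w s), Inl a]) @ [Inr (w r), Inl c, Inr (w (Suc r))] @ [Inl b, Inr (w (Suc s))] @ ys)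
      (?M + (\<Sum>i\<in>{Suc r..<e}. K i) + (\<Sum>i\<in>{Suc r..<e}. {#Inr (w i)#}))
      (?R \<union> (\<Union>i\<in>{Suc r..<e}. Q i) \<union> star c (w ` {Suc r..e}) \<union> star b (w ` {Suc r..e}))"
    by (simp only: append_assoc append_Cons append_Nil)
  have er: "estep (w r) (w (Suc r)) (K r) (Q r)"
    using assms(3) r by simp
  obtain d where 3: "reach ((xs @ [Inr (w s), Inl a]) @ [Inr (w r), Inl d, Inr (w (Suc r))] @ [Inl b, Inr (w (Suc s))] @ ys)
      (?M + (\<Sum>i\<in>{Suc r..<e}. K i) + (\<Sum>i\<in>{Suc r..<e}. {#Inr (w i)#}) + K r)
      (?R \<union> (\<Union>i\<in>{Suc r..<e}. Q i) \<union> star c (w ` {Suc r..e}) \<union> star b (w ` {Suc r..e}) \<union> Q r)"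
    using estep_reach[OF er 2] by (elim exE)
  \<comment> \<open>Deleting \<open>d\<close> and \<open>w (r + 1)\<close> lets \<open>b\<close>
    meet \<open>w r\<close>; the final move deletes \<open>a\<close> and \<open>w r\<close> and lets
    it meet \<open>w s\<close>. These two are the remaining neighbours of \<open>b\<close>.\<close>
  have 4: "reach ((xs @ [Inr (w s), Inl a]) @ [Inr (w r), Inl b, Inr (w (Suc s))] @ ys)
      (?M + (\<Sum>i\<in>{Suc r..<e}. K i) + (\<Sum>i\<in>{Suc r..<e}. {#Inr (w i)#}) + K r)
      (?R \<union> (\<Union>i\<in>{Suc r..<e}. Q i) \<union> star c (w ` {Suc r..e}) \<union> star b (w ` {Suc r..e}) \<union> Q r
        \<union> star b {w r})"
    by (rule reach_move'[OF 3, where xs = "xs @ [Inr (w s), Inl a, Inr (w r)]" and as = "[Inl d, Inr (w (Suc r))]"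
          and ys = "[Inl b, Inr (w (Suc s))] @ ys" and bs = "[]"])
      (use alt in \<open>simp_all add: successively_append_Cons2 adj_simps, blast\<close>)
  have sets: "{s<..<e} = insert r ({s<..<r} \<union> {Suc r..<e})"
      "{Suc s<..e} = insert e ({Suc s<..r} \<union> {Suc r..<e})"
      "{s..s + p} = insert s {s<..s + p}" "{r..e} = insert r {Suc r..e}" "{s + p..e} = {s + p..r} \<union> {Suc r..e}"
    using r by (auto simp: r_def)
  have sums: "(\<Sum>i\<in>{s<..<e}. K i) = K r + ((\<Sum>i\<in>{s<..<r}. K i) + (\<Sum>i\<in>{Suc r..<e}. K i))"
      "(\<Sum>i\<in>{Suc s<..e}. {#Inr (w i) :: 'u + 'v#}) =
        {#Inr (w e)#} + ((\<Sum>i\<in>{Suc s<..r}. {#Inr (w i)#}) + (\<Sum>i\<in>{Suc r..<e}. {#Inr (w i)#}))"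
    unfolding sets by (subst sum.insert; use r in \<open>auto intro!: sum.union_disjoint\<close>)+
  show "reach (xs @ [Inr (w s), Inl b, Inr (w (Suc s))] @ ys)
      (M + ({#Inl b, Inl c#} + (\<Sum>i\<in>{s<..<e}. K i) + (\<Sum>i\<in>{Suc s<..e}. {#Inr (w i)#})))
      (R \<union> ((\<Union>i\<in>{s<..<e}. Q i) \<union> star a (w ` {s..s + 2 * p}) \<union> star b (w ` ({s..s + p} \<union> {s + 2 * p..e}))
      \<union> star c (w ` {s + p..e})))"
    unfolding r_def[symmetric]
    by (rule reach_move'[OF 4, where xs = "xs @ [Inr (w s)]" and as = "[Inl a, Inr (w r)]"
          and ys = "[Inl b, Inr (w (Suc s))] @ ys" and bs = "[]"])
      (use alt in \<open>((simp add: successively_append_Cons2; fail) | (simp add: sums; fail) |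
        (simp add: sets image_Un adj_simps, (intro conjI; blast)))+\<close>)
qed

section \<open>Chains of pillows\<close>

lemma estep_cong: "estep x y K Q \<Longrightarrow> K' = K \<Longrightarrow> Q' = Q \<Longrightarrow> estep x y K' Q'"
  by simp

lemma fill_cong: "fill x y a K Q b \<Longrightarrow> K = K' \<Longrightarrow> Q = Q' \<Longrightarrow> fill x y a K' Q' b"
  by simp

text \<open>All of the path from \<open>s\<close> to \<open>e\<close> is played inside the edge from \<open>w s\<close> to \<open>w (s + 1)\<close>, with the short bars \<open>D i\<close> at
  the edge from \<open>w i\<close> to \<open>w (i + 1)\<close> and the long bars \<open>G\<close>.\<close>

definition region ::
  "(nat \<Rightarrow> 'v) \<Rightarrow> (nat \<Rightarrow> 'u list) \<Rightarrow> nat \<Rightarrow> nat \<Rightarrow> 'u multiset \<Rightarrow> ('u \<times> 'v) set \<Rightarrow> bool" where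
  "region w D e s G Q \<longleftrightarrow> estep (w s) (w (Suc s))
    (image_mset Inl G + (\<Sum>i\<in>{s..<e}. mset (map Inl (D i))) + (\<Sum>i\<in>{Suc s<..e}. {#Inr (w i)#}))
    (Q \<union> (\<Union>i\<in>{s..<e}. \<Union>d\<in>set (D i). star d {w i, w (Suc i)}))"

text \<open>The short bars at the edge \<open>s\<close> are played before the long bar
  \<open>a\<close> opens the rest. Therefore \<open>D s\<close> occurs in the region but not in the
  assumed \<open>fill\<close>.\<close>

lemma region_intro:
  fixes w :: "nat \<Rightarrow> 'v" and D :: "nat \<Rightarrow> 'u list"
  assumes "fill (w s) (w (Suc s)) a (image_mset Inl G
        + (\<Sum>i\<in>{s<..<e}. mset (map Inl (D i))) + (\<Sum>i\<in>{Suc s<..e}. {#Inr (w i)#}))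
      ((\<Union>i\<in>{s<..<e}. \<Union>d\<in>set (D i). star d {w i, w (Suc i)}) \<union> Q) b" "s < e"
  shows "region w D e s (add_mset a G) Q"
  unfolding region_def
proof (rule estep_cong[OF estep_fill[OF estep_list[of "w s" "w (Suc s)" "D s"] assms(1)]])
  have set: "{s..<e} = insert s {s<..<e}"
    using assms(2) by auto
  have "(\<Sum>i\<in>{s..<e}. mset (map Inl (D i) :: ('u + 'v) list)) =
      mset (map Inl (D s)) + (\<Sum>i\<in>{s<..<e}. mset (map Inl (D i)))"
    unfolding set by (subst sum.insert) auto
  then show "image_mset Inl (add_mset a G) + (\<Sum>i\<in>{s..<e}. mset (map Inl (D i)))
      + (\<Sum>i\<in>{Suc s<..e}. {#Inr (w i)#}) =
    mset (map Inl (D s)) + add_mset (Inl a) (image_mset Inl G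
      + (\<Sum>i\<in>{s<..<e}. mset (map Inl (D i))) + (\<Sum>i\<in>{Suc s<..e}. {#Inr (w i) :: 'u + 'v#}))"
    by simp
  show "Q \<union> (\<Union>i\<in>{s..<e}. \<Union>d\<in>set (D i). star d {w i, w (Suc i)}) =
      (\<Union>d\<in>set (D s). star d {w s, w (Suc s)}) \<union>
      ((\<Union>i\<in>{s<..<e}. \<Union>d\<in>set (D i). star d {w i, w (Suc i)}) \<union> Q)"
    unfolding set by blast
qed

lemma region_last_pillow:
  assumes "s + 2 \<le> e"
  shows "region w D e s {#a, b#} (star a (w ` {s..e}) \<union> star b (w ` {s..e}))"
  by (rule region_intro[where b = b])
    (use pillow[OF assms, of w "\<lambda>i. mset (map Inl (D i))" _ a b, OF estep_list] assms
      in \<open>simp_all add: Un_assoc\<close>)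

lemma region_theta:
  assumes "1 \<le> p" "s + 3 * p \<le> e"
  shows "region w D e s {#a, b, c#} (star a (w ` {s..s + 2 * p})
    \<union> star b (w ` ({s..s + p} \<union> {s + 2 * p..e})) \<union> star c (w ` {s + p..e}))"
  by (rule region_intro[where b = b])
    (use theta[OF assms, of w "\<lambda>i. mset (map Inl (D i))" _ a b c, OF estep_list] assms
      in \<open>simp_all add: Un_assoc image_Un\<close>)

text \<open>The last edge of the new pillow is filled by the given region, so pillows are nested in each other.\<close>

lemma region_pillow:
  fixes w :: "nat \<Rightarrow> 'v" and D :: "nat \<Rightarrow> 'u list"
  assumes "region w D e (s + q) G Q" "1 \<le> q" "s + q + 1 \<le> e"
  shows "region w D e s (G + {#a, b#}) (Q \<union> star a (w ` {s..s + q + 1}) \<union> star b (w ` {s..s + q + 1}))"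
proof -
  \<comment> \<open>The pillow covers \<open>s..s + q + 1\<close>. Its last edge starts at
    \<open>s + q\<close>, and there the whole remaining region takes the place of the short
    bars.\<close>
  define K :: "nat \<Rightarrow> ('u + 'v) multiset" where "K i = (if i = s + q then image_mset Inl G +
    (\<Sum>i\<in>{s + q..<e}. mset (map Inl (D i))) + (\<Sum>i\<in>{Suc (s + q)<..e}. {#Inr (w i)#})
    else mset (map Inl (D i)))" for i
  define Q' where "Q' i = (if i = s + q then
    Q \<union> (\<Union>i\<in>{s + q..<e}. \<Union>d\<in>set (D i). star d {w i, w (Suc i)})
    else (\<Union>d\<in>set (D i). star d {w i, w (Suc i)}))" for i
  have "estep (w i) (w (Suc i)) (K i) (Q' i)" for i
    using assms(1) estep_list[of "w i" "w (Suc i)" "D i"] by (simp add: K_def Q'_def region_def)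
  from pillow[of s "s + q + 1" w K Q' a b, OF _ this]
  have fill: "fill (w s) (w (Suc s)) a
      ({#Inl b#} + (\<Sum>i\<in>{s<..<s + q + 1}. K i) + (\<Sum>i\<in>{Suc s<..s + q + 1}. {#Inr (w i)#}))
      ((\<Union>i\<in>{s<..<s + q + 1}. Q' i) \<union> star a (w ` {s..s + q + 1}) \<union> star b (w ` {s..s + q + 1})) b"
    using assms(2) by simp
  have sets: "{s<..<s + q + 1} = insert (s + q) {s<..<s + q}" "{s<..<e} = {s<..<s + q} \<union> {s + q..<e}"
      "{Suc s<..e} = {Suc s<..s + q + 1} \<union> {Suc (s + q)<..e}"
    using assms(2,3) by auto
  have "(\<Sum>i\<in>{s<..<s + q + 1}. K i) = K (s + q) + (\<Sum>i\<in>{s<..<s + q}. K i)"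
    unfolding sets(1) by (subst sum.insert) auto
  also have "(\<Sum>i\<in>{s<..<s + q}. K i) = (\<Sum>i\<in>{s<..<s + q}. mset (map Inl (D i)))"
    by (rule sum.cong) (auto simp: K_def)
  finally have K: "(\<Sum>i\<in>{s<..<s + q + 1}. K i) = image_mset Inl G +
      (\<Sum>i\<in>{s + q..<e}. mset (map Inl (D i))) + (\<Sum>i\<in>{Suc (s + q)<..e}. {#Inr (w i)#})
      + (\<Sum>i\<in>{s<..<s + q}. mset (map Inl (D i)))"
    by (simp add: K_def)
  have D: "(\<Sum>i\<in>{s<..<e}. mset (map Inl (D i)) :: ('u + 'v) multiset) =
      (\<Sum>i\<in>{s<..<s + q}. mset (map Inl (D i))) + (\<Sum>i\<in>{s + q..<e}. mset (map Inl (D i)))"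
    unfolding sets(2) by (subst sum.union_disjoint) auto
  have V: "(\<Sum>i\<in>{Suc s<..e}. {#Inr (w i) :: 'u + 'v#}) =
      (\<Sum>i\<in>{Suc s<..s + q + 1}. {#Inr (w i)#}) + (\<Sum>i\<in>{Suc (s + q)<..e}. {#Inr (w i)#})"
    unfolding sets(3) by (subst sum.union_disjoint) auto
  have Q': "(\<Union>i\<in>{s<..<s + q + 1}. Q' i) = Q \<union> (\<Union>i\<in>{s<..<e}. \<Union>d\<in>set (D i). star d {w i, w (Suc i)})"
    unfolding sets(1,2) by (auto simp: Q'_def)
  have "region w D e s (add_mset a (add_mset b G))
      (Q \<union> star a (w ` {s..s + q + 1}) \<union> star b (w ` {s..s + q + 1}))"
  proof (rule region_intro[where b = b])
    show "fill (w s) (w (Suc s)) a (image_mset Inl (add_mset b G)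
        + (\<Sum>i\<in>{s<..<e}. mset (map Inl (D i))) + (\<Sum>i\<in>{Suc s<..e}. {#Inr (w i)#}))
      ((\<Union>i\<in>{s<..<e}. \<Union>d\<in>set (D i). star d {w i, w (Suc i)}) \<union>
        (Q \<union> star a (w ` {s..s + q + 1}) \<union> star b (w ` {s..s + q + 1}))) b"
    proof (rule fill_cong[OF fill])
      show "{#Inl b#} + (\<Sum>i\<in>{s<..<s + q + 1}. K i) + (\<Sum>i\<in>{Suc s<..s + q + 1}. {#Inr (w i)#}) =
        image_mset Inl (add_mset b G)
        + (\<Sum>i\<in>{s<..<e}. mset (map Inl (D i))) + (\<Sum>i\<in>{Suc s<..e}. {#Inr (w i)#})"
        unfolding K D V by simp
    qed (unfold Q', blast)
  qed (use assms in simp)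
  then show ?thesis
    by (simp add: add_mset_commute)
qed

text \<open>The last edge of pillow \<open>g\<close> is the first edge of pillow
  \<open>g + 1\<close>, so each pillow advances the path by only \<open>q\<close> although it has
  \<open>q + 2\<close> path bars. The induction prepends the pillows from the far end of the
  path.\<close>

lemma region_chain:
  assumes "region w D e (q * k) G Q" "1 \<le> q" "q * k + 1 \<le> e"
  shows "region w D e 0 (G + (\<Sum>g<k. {#a g, b g#}))
    (Q \<union> (\<Union>g<k. star (a g) (w ` {q * g..q * g + q + 1}) \<union> star (b g) (w ` {q * g..q * g + q + 1})))"
  using assms
proof (induction k arbitrary: G Q)
  case (Suc k)
  have "region w D e (q * k) (G + {#a k, b k#})
      (Q \<union> star (a k) (w ` {q * k..q * k + q + 1}) \<union> star (b k) (w ` {q * k..q * k + q + 1}))"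
    by (rule region_pillow) (use Suc.prems in \<open>simp_all add: add.commute\<close>)
  from Suc.IH[OF this] Suc.prems show ?case
    by (simp add: lessThan_Suc Un_ac add_ac)
qed simp

lemma region_reach:
  fixes w :: "nat \<Rightarrow> 'v" and D :: "nat \<Rightarrow> 'u list"
  assumes "region w D e 0 G Q" "G \<noteq> {#}" "1 \<le> e"
  shows "\<exists>wd. reach wd (image_mset Inl G + (\<Sum>i<e. mset (map Inl (D i))) + (\<Sum>i\<le>e. {#Inr (w i)#}))
    (Q \<union> (\<Union>i<e. \<Union>d\<in>set (D i). star d {w i, w (Suc i)}))"
proof -
  obtain a b K where K: "image_mset Inl G + (\<Sum>i\<in>{0..<e}. mset (map Inl (D i)))
      + (\<Sum>i\<in>{1<..e}. {#Inr (w i)#}) = add_mset (Inl a) K"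
    and fill: "fill (w 0) (w 1) a K (Q \<union> (\<Union>i\<in>{0..<e}. \<Union>d\<in>set (D i). star d {w i, w (Suc i)})) b"
    using assms(1,2) unfolding region_def estep_def by auto
  \<comment> \<open>The initial word supplies the first path edge together with the first inserted
    bar \<open>a\<close>; such a bar exists because \<open>G\<close> is nonempty.\<close>
  have "reach ([] @ [Inr (w 0), Inl a, Inr (w 1)] @ []) ({#} + mset [Inr (w 0), Inl a, Inr (w 1)])
      ({} \<union> adj ([] @ [Inr (w 0), Inl a, Inr (w 1)] @ []))"
    using reach_start by (intro reach_move[where as = "[]"]) auto
  from fillD[OF fill this]
  have 1: "reach [Inr (w 0), Inl b, Inr (w 1)] ({#Inr (w 0), Inl a, Inr (w 1)#} + K)
      (adj [Inr (w 0), Inl a, Inr (w 1)] \<union> (Q \<union> (\<Union>i\<in>{0..<e}. \<Union>d\<in>set (D i). star d {w i, w (Suc i)})))"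
    by simp
  have set: "{..e} = insert 0 (insert 1 {1<..e})"
    using assms(3) by auto
  have "(\<Sum>i\<le>e. {#Inr (w i) :: 'u + 'v#}) = {#Inr (w 0), Inr (w 1)#} + (\<Sum>i\<in>{1<..e}. {#Inr (w i)#})"
    unfolding set by simp
  then have "image_mset Inl G + (\<Sum>i<e. mset (map Inl (D i))) + (\<Sum>i\<le>e. {#Inr (w i)#}) =
      {#Inr (w 0), Inr (w 1)#} + add_mset (Inl a) K"
    unfolding K[symmetric] atLeast0LessThan by simp
  then show ?thesis
    by (intro exI) (rule reach_mono'[OF 1], auto simp: atLeast0LessThan)
qed

section \<open>Designs for complete bipartite graphs\<close>

definition drawable :: "nat \<Rightarrow> nat \<Rightarrow> nat \<Rightarrow> bool" where
  "drawable t m n \<longleftrightarrow> (\<exists>w M. reach w M ({..<m} \<times> {..<n}) \<and> (\<forall>x. count M x \<le> t) \<and>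
     set_mset M \<subseteq> Inl ` {..<m} \<union> Inr ` {..<n})"

section \<open>Exchanging the two sides of the bipartition\<close>

definition swap_sum :: "'a + 'b \<Rightarrow> 'b + 'a" where
  "swap_sum = case_sum Inr Inl"

lemma swap_sum_simps [simp]: "swap_sum (Inl a) = Inr a" "swap_sum (Inr b) = Inl b"
  by (simp_all add: swap_sum_def)

lemma swap_sum_swap_sum [simp]: "swap_sum (swap_sum x) = x"
  by (cases x) auto

lemma inj_swap_sum: "inj swap_sum"
  by (metis injI swap_sum_swap_sum)

lemma consec_map: "consec (map f w) = map_prod f f ` consec w"
  by (induction w rule: consec.induct) auto

lemma adj_map_swap_sum: "adj (map swap_sum w) = (adj w)\<inverse>"
proof -
  have "(swap_sum x, swap_sum y) \<in> map_prod swap_sum swap_sum ` consec w \<longleftrightarrow> (x, y) \<in> consec w" for x y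
    by (auto intro: rev_image_eqI dest: injD[OF inj_swap_sum])
  from this[of "Inr _" "Inl _"] this[of "Inl _" "Inr _"] show ?thesis
    by (auto simp: adj_def consec_map)
qed

lemma opp_swap_sum: "opp (swap_sum a) (swap_sum b) = opp a b"
  by (cases a; cases b) (auto simp: opp_def)

lemma game_swap: "game w M S \<Longrightarrow> game (map swap_sum w) (image_mset swap_sum M) (S\<inverse>)"
proof (induction rule: game.induct)
  case (move xs as ys M S bs)
  have "game (map swap_sum xs @ map swap_sum bs @ map swap_sum ys)
      (image_mset swap_sum M + mset (map swap_sum bs))
      (S\<inverse> \<union> adj (map swap_sum xs @ map swap_sum bs @ map swap_sum ys))"
    using move.IH move.hyps(2)
    by (intro game.move[where as = "map swap_sum as"])
      (simp_all add: successively_map opp_swap_sum flip: map_append)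
  then show ?case
    by (simp add: adj_map_swap_sum converse_Un flip: map_append)
qed (simp add: game.start)

lemma count_image_mset_swap_sum: "count (image_mset swap_sum M) x = count M (swap_sum x)"
proof -
  have "swap_sum -` {x} = {swap_sum x}"
    by (auto intro: injD[OF inj_swap_sum])
  then show ?thesis
    by (cases "swap_sum x \<in># M") (auto simp: count_image_mset not_in_iff)
qed

lemma drawable_sym:
  assumes "drawable t m n"
  shows "drawable t n m"
proof -
  obtain w M S where wM: "game w M S" "{..<m} \<times> {..<n} \<subseteq> S" "\<forall>x. count M x \<le> t"
      "set_mset M \<subseteq> Inl ` {..<m} \<union> Inr ` {..<n}"
    using assms unfolding drawable_def reach_def by auto
  have "count (image_mset swap_sum M) x \<le> t" for x
    using wM(3) count_image_mset_swap_sum[of M x] by simp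
  moreover have "set_mset (image_mset swap_sum M) \<subseteq> Inl ` {..<n} \<union> Inr ` {..<m}"
    using wM(4) by fastforce
  moreover have "reach (map swap_sum w) (image_mset swap_sum M) ({..<n} \<times> {..<m})"
    unfolding reach_def using game_swap[OF wM(1)] wM(2) by (intro exI conjI) auto
  ultimately show ?thesis
    unfolding drawable_def by blast
qed

text \<open>The first move erases the whole old word, so blocks follow each other without sharing
  bars. The case \<open>T = []\<close> serves the last block when the number of vertices to be
  paired is odd.\<close>

lemma reach_block:
  fixes k :: nat
  assumes "reach w M Q" "T = [] \<or> T = [Inl b]"
  shows "reach (Inl a # Inr k # T) (M + {#Inl a#} + mset T + (\<Sum>i\<le>k. {#Inr i#}))
    (Q \<union> star a {..k} \<union> (if T = [] then {} else star b {..k}))"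
proof (induction k)
  case 0
  show ?case
    by (rule reach_move'[OF assms(1), where xs = "[]" and as = w and ys = "[]" and bs = "Inl a # Inr 0 # T"])
      (use assms(2) in \<open>auto simp: adj_simps\<close>)
next
  case (Suc k)
  show ?case
    by (rule reach_move'[OF Suc.IH, where xs = "[Inl a]" and as = "[Inr k]" and ys = T and bs = "[Inr (Suc k)]"])
      (use assms(2) in \<open>auto simp: adj_simps atMost_Suc\<close>)
qed

text \<open>A block serves two vertices of the small side with one bar each and costs every vertex
  of the other side one bar. The number of blocks is \<open>m / 2\<close> rounded up, hence at most
  \<open>t\<close>.\<close>

lemma drawable_small_side:
  assumes "m \<le> 2 * t" "0 < m" "0 < n"
  shows "drawable t m n"
proof -
  obtain k where n: "n = Suc k"
    using assms(3) gr0_conv_Suc by auto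
  have "\<exists>w. reach w (mset_set (Inl ` {..<min (2 * g) m}) + (\<Sum>j<g. \<Sum>i\<le>k. {#Inr i#}))
      ({..<min (2 * g) m} \<times> {..<n})" if "2 * g \<le> Suc m" for g
    using that
  proof (induction g)
    case 0
    then show ?case
      using reach_start by auto
  next
    case (Suc g)
    then obtain w where w: "reach w (mset_set (Inl ` {..<min (2 * g) m}) + (\<Sum>j<g. \<Sum>i\<le>k. {#Inr i#}))
      ({..<min (2 * g) m} \<times> {..<n})"
      by auto
    have "2 * g < m"
      using Suc.prems by simp
    then consider "m = Suc (2 * g)" | "Suc (2 * g) < m"
      by linarith
    then show ?case
    proof cases
      case 1
      then have set: "{..<min (2 * g) m} = {..<2 * g}" "{..<min (2 * Suc g) m} = insert (2 * g) {..<2 * g}"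
        by auto
      show ?thesis
        unfolding set(2)
        by (intro exI, rule reach_mono'[OF reach_block[OF w[unfolded set(1)], of "[]" _ "2 * g" k]], simp)
          (auto simp: star_def n image_iff)
    next
      case 2
      then have set: "{..<min (2 * g) m} = {..<2 * g}"
          "{..<min (2 * Suc g) m} = insert (Suc (2 * g)) (insert (2 * g) {..<2 * g})"
        by auto
      show ?thesis
        unfolding set(2)
        by (intro exI, rule reach_mono'[OF reach_block[OF w[unfolded set(1)],
              of "[Inl (Suc (2 * g))]" "Suc (2 * g)" "2 * g" k]], simp)
          (auto simp: star_def n image_iff)
    qed
  qed
  moreover have "min (2 * (Suc m div 2)) m = m" "2 * (Suc m div 2) \<le> Suc m"
    by presburger+
  ultimately obtain w where
    w: "reach w (mset_set (Inl ` {..<m}) + (\<Sum>j<Suc m div 2. \<Sum>i\<le>k. {#Inr i#})) ({..<m} \<times> {..<n})"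
    by metis
  have "Suc m div 2 \<le> t" "1 \<le> t"
    using assms by auto
  then have "count (mset_set (Inl ` {..<m}) + (\<Sum>j<Suc m div 2. \<Sum>i\<le>k. {#Inr i#})) x \<le> t" for x :: "nat + nat"
    by (cases x) (auto simp: count_sum count_mset_set' image_iff cong: if_cong)
  moreover have "set_mset (mset_set (Inl ` {..<m}) + (\<Sum>j<Suc m div 2. \<Sum>i\<le>k. {#Inr i#}))
      \<subseteq> Inl ` {..<m} \<union> Inr ` {..<n}"
    by (auto simp: set_mset_sum n)
  ultimately show ?thesis
    using w unfolding drawable_def by blast
qed

text \<open>The short bars need only the edges of the first period, where every pair of cyclically
  consecutive labels occurs; \<open>n <= e\<close> provides the edge from label \<open>n - 1\<close>
  back to label \<open>0\<close>. A vertex \<open>u\<close> has one long bar and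
  \<open>card (E u) < t\<close> short ones, and every label occurs \<open>t\<close> times among
  \<open>t * n\<close> positions.\<close>

lemma drawable_design:
  fixes e :: nat
  assumes region: "region (\<lambda>i. i mod n) (\<lambda>i. if i < n then filter (\<lambda>u. i \<in> E u) [0..<m] else []) e 0
      (mset_set {..<m}) Q"
    and e: "Suc e = t * n" "n \<le> e" and t: "1 \<le> t" and m: "0 < m" and n: "0 < n"
    and E: "\<And>u. u < m \<Longrightarrow> finite (E u) \<and> card (E u) < t \<and> E u \<subseteq> {..<n}"
    and cover: "\<And>u v. u < m \<Longrightarrow> v < n \<Longrightarrow> (u, v) \<in> Q \<or> v \<in> E u \<or> (\<exists>i\<in>E u. v = Suc i mod n)"
  shows "drawable t m n"
proof -
  define D where "D i = (if i < n then filter (\<lambda>u. i \<in> E u) [0..<m] else [])" for i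
  define M :: "(nat + nat) multiset" where
    "M = image_mset Inl (mset_set {..<m}) + (\<Sum>i<e. mset (map Inl (D i))) + (\<Sum>i\<le>e. {#Inr (i mod n)#})"
  have "mset_set {..<m} \<noteq> {#}"
    using m by (auto simp: mset_set_empty_iff)
  then obtain wd where wd: "reach wd M
      (Q \<union> (\<Union>i<e. \<Union>d\<in>set (D i). star d {i mod n, Suc i mod n}))"
    using region_reach[OF region[folded D_def]] e n unfolding M_def by auto
  have "{..<m} \<times> {..<n} \<subseteq> Q \<union> (\<Union>i<e. \<Union>d\<in>set (D i). star d {i mod n, Suc i mod n})"
  proof safe
    fix u v assume uv: "u < m" "v < n" "(u, v) \<notin> (\<Union>i<e. \<Union>d\<in>set (D i). star d {i mod n, Suc i mod n})"
    have edge: "(u, i mod n) \<in> (\<Union>i<e. \<Union>d\<in>set (D i). star d {i mod n, Suc i mod n})"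
        "(u, Suc i mod n) \<in> (\<Union>i<e. \<Union>d\<in>set (D i). star d {i mod n, Suc i mod n})" if "i \<in> E u" for i
    proof -
      have "i < n"
        using E[of u] uv(1) that by auto
      then have "u \<in> set (D i)" "i < e"
        using that uv(1) e by (auto simp: D_def)
      then show "(u, i mod n) \<in> (\<Union>i<e. \<Union>d\<in>set (D i). star d {i mod n, Suc i mod n})"
        "(u, Suc i mod n) \<in> (\<Union>i<e. \<Union>d\<in>set (D i). star d {i mod n, Suc i mod n})"
        by - (rule UN_I[of i], simp, rule UN_I[of u], assumption, simp)+
    qed
    show "(u, v) \<in> Q"
      using cover[OF uv(1,2)]
    proof (elim disjE bexE)
      assume v: "v \<in> E u"
      then show ?thesis
        using edge(1)[OF v] uv(2,3) by simp
    next
      fix i assume i: "i \<in> E u" "v = Suc i mod n"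
      then show ?thesis
        using edge(2)[OF i(1)] uv(3) by simp
    qed
  qed
  with wd have "reach wd M ({..<m} \<times> {..<n})"
    by (rule reach_mono)
  moreover have "count M x \<le> t" for x
  proof (cases x)
    case (Inl u)
    have cD: "count (mset (map Inl (D i))) (Inl u :: nat + nat) = (if i < n \<and> u < m \<and> i \<in> E u then 1 else 0)" for i
    proof -
      have "distinct (map Inl (D i) :: (nat + nat) list)"
        by (auto simp: D_def distinct_map)
      then have "count (mset (map Inl (D i))) (Inl u :: nat + nat) =
          (if Inl u \<in> set (map Inl (D i) :: (nat + nat) list) then 1 else 0)"
        unfolding distinct_count_atmost_1 by blast
      then show ?thesis
        by (auto simp: D_def)
    qed
    have c1: "count (image_mset Inl (mset_set {..<m})) (Inl u :: nat + nat) = (if u < m then 1 else 0)"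
      by (simp add: image_mset_mset_set count_mset_set' inj_image_mem_iff)
    have c2: "count (\<Sum>i\<le>e. {#Inr (i mod n) :: nat + nat#}) (Inl u) = 0"
      by (simp add: count_sum)
    have "count M x = (if u < m then 1 else 0) + (\<Sum>i<e. if i < n \<and> u < m \<and> i \<in> E u then 1 else 0)"
      unfolding M_def Inl by (simp only: count_union c1 c2 count_sum cD) simp
    also have "\<dots> \<le> t"
    proof (cases "u < m")
      case True
      have "(\<Sum>i<e. if i < n \<and> u < m \<and> i \<in> E u then 1 else 0) = (\<Sum>i\<in>{..<e} \<inter> {i. i < n \<and> u < m \<and> i \<in> E u}. 1 :: nat)"
        by (simp add: sum.If_cases)
      also have "\<dots> \<le> card (E u)"
        using E[OF True] by (auto intro: card_mono)
      finally show ?thesis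
        using E[OF True] True by simp
    qed simp
    finally show ?thesis .
  next
    case (Inr v)
    have c1: "count (image_mset Inl (mset_set {..<m})) (Inr v :: nat + nat) = 0"
      by (simp add: image_mset_mset_set count_mset_set' image_iff)
    have c2: "count (mset (map Inl (D i))) (Inr v :: nat + nat) = 0" for i
      by (simp add: count_eq_zero_iff image_iff)
    have "count M x = (\<Sum>i\<le>e. if i mod n = v then 1 else 0)"
      unfolding M_def Inr by (simp only: count_union c1 c2 count_sum) (simp cong: if_cong)
    also have "\<dots> = card ({..e} \<inter> {i. i mod n = v})"
      by (simp add: sum.If_cases)
    also have "\<dots> \<le> card ((\<lambda>k. k * n + v) ` {..<t})"
    proof (rule card_mono)
      show "{..e} \<inter> {i. i mod n = v} \<subseteq> (\<lambda>k. k * n + v) ` {..<t}"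
      proof
        fix i assume "i \<in> {..e} \<inter> {i. i mod n = v}"
        then have "i < t * n" "v = i mod n"
          using e by auto
        from this(1) have "i div n < t"
          using n by (simp add: div_less_iff_less_mult)
        then show "i \<in> (\<lambda>k. k * n + v) ` {..<t}"
          using \<open>v = i mod n\<close> by (intro image_eqI[of _ _ "i div n"]) auto
      qed
    qed simp
    also have "\<dots> \<le> t"
      using card_image_le[of "{..<t}"] by simp
    finally show ?thesis .
  qed
  moreover have "set_mset M \<subseteq> Inl ` {..<m} \<union> Inr ` {..<n}"
    using n by (auto simp: M_def set_mset_sum D_def split: if_splits)
  ultimately show ?thesis
    unfolding drawable_def by blast
qed

text \<open>Every other edge of the path from position \<open>s\<close> on, moved to the first period of the labelling.\<close>

definition gap_edges :: "nat \<Rightarrow> nat \<Rightarrow> nat \<Rightarrow> nat set" where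
  "gap_edges n s k = (\<lambda>r. (s + 2 * r) mod n) ` {..<k}"

lemma gap_edges: "finite (gap_edges n s k)" "card (gap_edges n s k) \<le> k"
  "0 < n \<Longrightarrow> gap_edges n s k \<subseteq> {..<n}"
  using card_image_le[of "{..<k}"] by (auto simp: gap_edges_def)

lemma gap_edges_cover:
  assumes "r < 2 * k"
  shows "(s + r) mod n \<in> gap_edges n s k \<or> (\<exists>i\<in>gap_edges n s k. (s + r) mod n = Suc i mod n)"
proof (cases "even r")
  case True
  then have "(s + r) mod n = (s + 2 * (r div 2)) mod n"
    by simp
  then show ?thesis
    using assms unfolding gap_edges_def by auto
next
  case False
  then have "r = Suc (2 * (r div 2))"
    by presburger
  then have "(s + r) mod n = Suc ((s + 2 * (r div 2)) mod n) mod n"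
    by (metis add_Suc_right mod_Suc_eq)
  then show ?thesis
    using assms unfolding gap_edges_def by auto
qed

lemma ex_shift_mod:
  fixes n v s :: nat
  assumes "v < n"
  obtains r where "r < n" "v = (s + r) mod n"
proof
  \<comment> \<open>Modulo \<open>n\<close> the number \<open>(n - 1) * s\<close> stands for
    \<open>-s\<close>, which avoids subtraction.\<close>
  have "(s + (v + (n - 1) * s) mod n) mod n = (s + (v + (n - 1) * s)) mod n"
    by (simp add: mod_add_right_eq)
  also have "s + (v + (n - 1) * s) = v + n * s"
    using assms by (cases n) auto
  finally show "v = (s + (v + (n - 1) * s) mod n) mod n"
    using assms by simp
qed (use assms in simp)

text \<open>Any \<open>n\<close> consecutive positions carry all labels. The first \<open>l\<close>
  of them are those of the long bar, and the other \<open>2 * k\<close> split into consecutive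
  pairs.\<close>

lemma interval_cover:
  assumes "v < n" "n = l + 2 * k"
  shows "v \<in> (\<lambda>i. i mod n) ` {s..<s + l} \<or> v \<in> gap_edges n (s + l) k
    \<or> (\<exists>i\<in>gap_edges n (s + l) k. v = Suc i mod n)"
proof -
  obtain r where r: "r < n" "v = (s + r) mod n"
    using ex_shift_mod[OF assms(1)] .
  show ?thesis
  proof (cases "r < l")
    case True
    then show ?thesis
      using r by auto
  next
    case False
    then have "r - l < 2 * k" "s + r = s + l + (r - l)"
      using r assms by auto
    then show ?thesis
      using gap_edges_cover[of "r - l" k "s + l" n] r by simp
  qed
qed

lemma sum_pairs: "(\<Sum>g<k. {#2 * g, Suc (2 * g)#}) = mset_set {..<2 * k}"
  by (induction k) (auto simp: lessThan_Suc)

lemma mem_star: "(u, v) \<in> star a X \<longleftrightarrow> u = a \<and> v \<in> X"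
  by (auto simp: star_def)

lemma drawable_even:
  assumes "0 < k" "1 \<le> q" "n = 2 * t + q" "2 \<le> t" "q * k + 2 \<le> t * n"
  shows "drawable t (2 * k) n"
proof -
  obtain j where k: "k = Suc j"
    using assms(1) gr0_conv_Suc by auto
  define e where "e = t * n - 1"
  \<comment> \<open>Vertices \<open>2 * g\<close> and \<open>2 * g + 1\<close> are the two faces of
    pillow \<open>g\<close>, which starts at \<open>q * g\<close>; their gap begins right after the
    \<open>q + 2\<close> labels of the pillow.\<close>
  define E where "E u = gap_edges n (q * (u div 2) + (q + 2)) (t - 1)" for u
  define D where "D i = (if i < n then filter (\<lambda>u. i \<in> E u) [0..<2 * k] else [])" for i
  define w where "w i = i mod n" for i :: nat
  have tn: "2 * n \<le> t * n" "0 < n"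
    using mult_le_mono1[OF assms(4), of n] assms(2,3) by auto
  then have e: "Suc e = t * n" "n \<le> e"
    unfolding e_def by linarith+
  have le: "q * j + q + 1 \<le> e"
    using assms(5) e(1) by (simp add: k)
  have len: "n = q + 2 + 2 * (t - 1)"
    using assms(3,4) by simp
  \<comment> \<open>The last pillow extends to the end \<open>e\<close>, so that surplus path bars
    are absorbed there.\<close>
  define Q where "Q = star (2 * j) (w ` {q * j..e}) \<union> star (Suc (2 * j)) (w ` {q * j..e}) \<union>
    (\<Union>g<j. star (2 * g) (w ` {q * g..q * g + q + 1}) \<union> star (Suc (2 * g)) (w ` {q * g..q * g + q + 1}))"
  have "region w D e (q * j) {#2 * j, Suc (2 * j)#}
      (star (2 * j) (w ` {q * j..e}) \<union> star (Suc (2 * j)) (w ` {q * j..e}))"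
    by (rule region_last_pillow) (use le assms(2) in simp)
  from region_chain[OF this, of "\<lambda>g. 2 * g" "\<lambda>g. Suc (2 * g)"]
  have region: "region w D e 0 (mset_set {..<2 * k}) Q"
    using le assms(2) sum_pairs[of "Suc j"] by (simp add: k Q_def add_ac)
  have Q: "(u, w i) \<in> Q" if "u < 2 * k" "i \<in> {q * (u div 2)..<q * (u div 2) + (q + 2)}" for u i
  proof -
    have "u = 2 * (u div 2) \<or> u = Suc (2 * (u div 2))"
      by presburger
    then obtain g where g: "u = 2 * g \<or> u = Suc (2 * g)"
      by blast
    then have u: "u div 2 = g" "g \<le> j"
      using that(1) k by auto
    show ?thesis
    proof (cases "g < j")
      case True
      have "w i \<in> w ` {q * g..q * g + q + 1}"
        using that(2) unfolding u by auto
      then show ?thesis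
        using g True by (auto simp: Q_def mem_star)
    next
      case False
      then have "w i \<in> w ` {q * j..e}"
        using that(2) le u by auto
      then show ?thesis
        using g False u(2) by (auto simp: Q_def mem_star)
    qed
  qed
  show ?thesis
  proof (rule drawable_design[OF region[unfolded w_def D_def] e])
    fix u v assume uv: "u < 2 * k" "v < n"
    have "v \<in> w ` {q * (u div 2)..<q * (u div 2) + (q + 2)} \<or> v \<in> E u \<or> (\<exists>i\<in>E u. v = Suc i mod n)"
      using interval_cover[OF uv(2) len, of "q * (u div 2)"]
      unfolding E_def w_def by (simp add: add.assoc)
    then show "(u, v) \<in> Q \<or> v \<in> E u \<or> (\<exists>i\<in>E u. v = Suc i mod n)"
      using Q[OF uv(1)] by blast
  next
    fix u
    have "finite (E u)" "card (E u) \<le> t - 1" "E u \<subseteq> {..<n}"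
      unfolding E_def using gap_edges tn(2) by blast+
    then show "finite (E u) \<and> card (E u) < t \<and> E u \<subseteq> {..<n}"
      using assms(4) by simp
  qed (use assms tn in auto)
qed

text \<open>The three faces of the theta graph have \<open>q + 2\<close>, \<open>q + 2\<close> and at least \<open>q + 3\<close> labels. The labels missed by the third
  one form two gaps of \<open>p - 1\<close> and \<open>2 t - 2 - p\<close> labels, exactly one of which is odd, and the surplus label pays
  for rounding up.\<close>

lemma drawable_odd:
  assumes "1 \<le> q" "n = 2 * t + q" "2 \<le> t" "q + 1 = 2 * p" "p \<le> 2 * t - 2" "q * k + 3 * p + 1 \<le> t * n"
  shows "drawable t (2 * k + 3) n"
proof -
  define e where "e = t * n - 1"
  define s where "s = q * k"
  \<comment> \<open>Every face except \<open>2 * k + 1\<close> sees \<open>q + 2 = 2 * p + 1\<close>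
    consecutive positions starting at \<open>f u\<close>; in the theta graph these start at
    \<open>s\<close> and at \<open>s + p\<close>.\<close>
  define f where "f u = (if u = 2 * k + 2 then s + p else q * (u div 2))" for u
  define E where "E u = (if u = 2 * k + 1
    then gap_edges n (s + p + 1) (p div 2) \<union> gap_edges n (s + 3 * p + 1) ((2 * t - 1 - p) div 2)
    else gap_edges n (f u + (q + 2)) (t - 1))" for u
  define D where "D i = (if i < n then filter (\<lambda>u. i \<in> E u) [0..<2 * k + 3] else [])" for i
  define w where "w i = i mod n" for i :: nat
  have tn: "2 * n \<le> t * n" "0 < n"
    using mult_le_mono1[OF assms(3), of n] assms(1,2) by auto
  then have e: "Suc e = t * n" "n \<le> e"
    unfolding e_def by linarith+
  have p: "1 \<le> p"
    using assms(1,4) by simp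
  have le: "s + 3 * p \<le> e"
    using assms(6) e(1) by (simp add: s_def)
  have len: "n = q + 2 + 2 * (t - 1)"
    using assms(2,3) by simp
  define Q where "Q = star (2 * k) (w ` {s..s + 2 * p})
    \<union> star (2 * k + 1) (w ` ({s..s + p} \<union> {s + 2 * p..e})) \<union> star (2 * k + 2) (w ` {s + p..e}) \<union>
    (\<Union>g<k. star (2 * g) (w ` {q * g..q * g + q + 1}) \<union> star (Suc (2 * g)) (w ` {q * g..q * g + q + 1}))"
  have "region w D e (q * k) {#2 * k, 2 * k + 1, 2 * k + 2#} (star (2 * k) (w ` {s..s + 2 * p})
    \<union> star (2 * k + 1) (w ` ({s..s + p} \<union> {s + 2 * p..e})) \<union> star (2 * k + 2) (w ` {s + p..e}))"
    unfolding s_def[symmetric] by (rule region_theta) (use p le in auto)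
  from region_chain[OF this, of "\<lambda>g. 2 * g" "\<lambda>g. Suc (2 * g)"]
  have "region w D e 0 ({#2 * k, 2 * k + 1, 2 * k + 2#} + mset_set {..<2 * k}) Q"
    unfolding sum_pairs using le p assms(1) by (simp add: Q_def s_def)
  moreover have "{#2 * k, 2 * k + 1, 2 * k + 2#} + mset_set {..<2 * k} = mset_set {..<2 * k + 3}"
    by (simp add: lessThan_Suc numeral_3_eq_3)
  ultimately have region: "region w D e 0 (mset_set {..<2 * k + 3}) Q"
    by simp
  have Q: "(u, w i) \<in> Q" if "u < 2 * k + 3" "u \<noteq> 2 * k + 1" "i \<in> {f u..<f u + (q + 2)}" for u i
  proof -
    have "u = 2 * (u div 2) \<or> u = Suc (2 * (u div 2))"
      by presburger
    then obtain g where g: "u = 2 * g \<or> u = Suc (2 * g)"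
      by blast
    then have u: "u div 2 = g" "g \<le> Suc k"
      using that(1) by auto
    consider "g < k" | "g = k" | "g = Suc k"
      using u(2) by linarith
    then show ?thesis
    proof cases
      case 1
      have "w i \<in> w ` {q * g..q * g + q + 1}"
        using that(3) g 1 unfolding f_def u by (auto split: if_splits)
      then show ?thesis
        using g 1 by (auto simp: Q_def mem_star)
    next
      case 2
      then have "w i \<in> w ` {s..s + 2 * p}" "u = 2 * k"
        using that(2,3) g assms(4) u(1) by (auto simp: f_def s_def split: if_splits)
      then show ?thesis
        by (auto simp: Q_def mem_star)
    next
      case 3
      then have "w i \<in> w ` {s + p..e}" "u = 2 * k + 2"
        using that(1,3) g assms(4) le by (auto simp: f_def split: if_splits)
      then show ?thesis
        by (auto simp: Q_def mem_star)
    qed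
  qed
  show ?thesis
  proof (rule drawable_design[OF region[unfolded w_def D_def] e])
    fix u v assume uv: "u < 2 * k + 3" "v < n"
    show "(u, v) \<in> Q \<or> v \<in> E u \<or> (\<exists>i\<in>E u. v = Suc i mod n)"
    proof (cases "u = 2 * k + 1")
      case True
      obtain r where r: "r < n" "v = (s + r) mod n"
        using ex_shift_mod[OF uv(2)] .
      consider "r \<le> p \<or> 2 * p \<le> r \<and> r \<le> 3 * p" | "p < r" "r < 2 * p" | "3 * p < r"
        by linarith
      then show ?thesis
      proof cases
        case 1
        then have "v \<in> w ` ({s..s + p} \<union> {s + 2 * p..e})"
          using r le by (intro image_eqI[of _ _ "s + r"]) (auto simp: w_def)
        then show ?thesis
          using True by (auto simp: Q_def mem_star)
      next
        case 2
        then have "r - p - 1 < 2 * (p div 2)" "s + r = s + p + 1 + (r - p - 1)"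
          by presburger+
        then show ?thesis
          using gap_edges_cover[of "r - p - 1" "p div 2" "s + p + 1" n] r True by (auto simp: E_def)
      next
        case 3
        have "n + 1 = 2 * t + 2 * p"
          using assms(2,4) by simp
        with 3 r(1) assms(5) have "r - 3 * p - 1 < 2 * t - 1 - p - 1" "s + r = s + 3 * p + 1 + (r - 3 * p - 1)"
          by linarith+
        moreover have "y - 1 \<le> 2 * (y div 2)" for y :: nat
          by presburger
        ultimately have "r - 3 * p - 1 < 2 * ((2 * t - 1 - p) div 2)" "s + r = s + 3 * p + 1 + (r - 3 * p - 1)"
          using less_le_trans by blast+
        then show ?thesis
          using gap_edges_cover[of "r - 3 * p - 1" "(2 * t - 1 - p) div 2" "s + 3 * p + 1" n] r True
          by (auto simp: E_def)
      qed
    next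
      case False
      have "v \<in> w ` {f u..<f u + (q + 2)} \<or> v \<in> E u \<or> (\<exists>i\<in>E u. v = Suc i mod n)"
        using interval_cover[OF uv(2) len, of "f u"] False
        unfolding E_def w_def by (simp add: add.assoc)
      then show ?thesis
        using Q[OF uv(1) False] by blast
    qed
  next
    fix u assume "u < 2 * k + 3"
    have "card (E u) \<le> t - 1"
    proof (cases "u = 2 * k + 1")
      case True
      have "card (E u) \<le> card (gap_edges n (s + p + 1) (p div 2)) +
          card (gap_edges n (s + 3 * p + 1) ((2 * t - 1 - p) div 2))"
        using True card_Un_le unfolding E_def by simp
      also have "\<dots> \<le> p div 2 + (2 * t - 1 - p) div 2"
        by (rule add_mono[OF gap_edges(2) gap_edges(2)])
      also have "\<dots> \<le> (p + (2 * t - 1 - p)) div 2"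
        by (subst div_add1_eq) (rule le_add1)
      also have "p + (2 * t - 1 - p) = 2 * t - 1"
        using assms(3,5) by simp
      also have "(2 * t - 1) div 2 = t - 1"
        by presburger
      finally show ?thesis .
    qed (simp add: E_def gap_edges(2))
    moreover have "finite (E u)" "E u \<subseteq> {..<n}"
      unfolding E_def using gap_edges(1,3) tn(2) by (simp_all split: if_splits)
    ultimately show "finite (E u) \<and> card (E u) < t \<and> E u \<subseteq> {..<n}"
      using assms(3) by simp
  qed (use assms tn in auto)
qed

text \<open>By symmetry one may arrange that \<open>m\<close> is even, or that both are odd with
  \<open>n <= m\<close>. In the odd case this order bounds \<open>q\<close> by the geometric mean of
  \<open>p\<close> and \<open>q\<close>, which is less than \<open>2 * t\<close>, so the gap lengths
  in \<open>drawable_odd\<close> are not negative.\<close>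

lemma drawable_if_edge_bound:
  assumes "0 < m" "0 < n" "m * n + 4 \<le> 2 * t * (m + n)"
  shows "drawable t m n"
proof -
  have main: "drawable t m n"
    if mn: "0 < m" "0 < n" "m * n + 4 \<le> 2 * t * (m + n)" "even m \<or> n \<le> m \<and> odd n" for m n
  proof -
    consider "m \<le> 2 * t" | "n \<le> 2 * t" | "2 * t < m" "2 * t < n"
      by linarith
    then show ?thesis
    proof cases
      case 1
      then show ?thesis
        using drawable_small_side mn by blast
    next
      case 2
      then show ?thesis
        using drawable_small_side[THEN drawable_sym] mn by blast
    next
      case 3
      define p q where "p = m - 2 * t" and "q = n - 2 * t"
      with 3 have pq: "m = 2 * t + p" "n = 2 * t + q" "1 \<le> p" "1 \<le> q"
        by simp_all
      have le: "m * q + 4 \<le> 2 * (t * n)"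
        using mn(3) by (simp add: pq(2) algebra_simps)
      \<comment> \<open>This is the edge bound in symmetric form, since \<open>(m - 2 * t) * (n - 2
        * t) = m * n - 2 * t * (m + n) + 4 * t * t\<close>.\<close>
      have "p * q + 4 \<le> 4 * (t * t)"
        using mn(3) by (simp add: pq algebra_simps)
      moreover have "1 \<le> p * q"
        using pq by simp
      ultimately have t: "2 \<le> t"
        by (cases "t = 0 \<or> t = 1") auto
      show ?thesis
      proof (cases "even m")
        case True
        then obtain k where k: "m = 2 * k"
          by (elim evenE)
        have "2 * (q * k) + 4 \<le> 2 * (t * n)"
          using le by (simp add: k algebra_simps)
        then have "q * k + 2 \<le> t * n"
          by linarith
        then show ?thesis
          using drawable_even[of k q n t] mn(1) pq(2,4) t k by simp
      next
        case False
        then have odd: "odd m" "odd q" "q \<le> p"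
          using mn(4) pq by auto
        obtain j where j: "m = 2 * j + 1"
          using odd(1) by (elim oddE)
        then have k: "m = 2 * (j - 1) + 3"
          using 3(1) t by simp
        have "even (q + 1)"
          using odd(2) by simp
        then obtain r where r: "q + 1 = 2 * r"
          by (elim evenE)
        have "q * q < 4 * (t * t)"
          using \<open>p * q + 4 \<le> 4 * (t * t)\<close> mult_le_mono1[OF odd(3), of q] by linarith
        then have "q < 2 * t"
          using mult_le_mono[of "2 * t" q "2 * t" q] by (cases "q < 2 * t") simp_all
        then have r2: "r \<le> 2 * t - 2"
          using r t by linarith
        have "2 * (q * (j - 1)) + 3 * q + 4 \<le> 2 * (t * n)"
          using le by (subst (asm) k) (simp add: algebra_simps)
        then have "q * (j - 1) + 3 * r + 1 \<le> t * n"
          using r by linarith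
        then show ?thesis
          using drawable_odd[of q n t r "j - 1"] pq(2,4) t r r2 k by metis
      qed
    qed
  qed
  show ?thesis
  proof (cases "even m \<or> n \<le> m \<and> odd n")
    case True
    then show ?thesis
      using main assms by blast
  next
    case False
    then have "even n \<or> m \<le> n \<and> odd m"
      by auto
    moreover have "n * m + 4 \<le> 2 * t * (n + m)"
      using assms(3) by (simp only: mult.commute[of n m] add.commute[of n m])
    ultimately show ?thesis
      using main[of n m] assms(1,2) by (blast intro: drawable_sym[of t n m])
  qed
qed

section \<open>Drawing words by bars\<close>

lemma consec_sorted:
  assumes "sorted_wrt (<) (c :: 'a :: linorder list)"
  shows "(y, z) \<in> consec c \<longleftrightarrow> y \<in> set c \<and> z \<in> set c \<and> y < z \<and> (\<forall>x\<in>set c. \<not> (y < x \<and> x < z))"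
  using assms
proof (induction c rule: consec.induct)
  case (1 a b c)
  then show ?case
    by (auto 0 3 dest: less_trans)
qed auto

lemma consec_successively: "successively P w \<Longrightarrow> (a, b) \<in> consec w \<Longrightarrow> P a b"
  by (induction w rule: consec.induct) auto

text \<open>A bar is identified with its height, which is why heights are never reused; column \<open>i\<close> lists the bars over
  the interval from \<open>i\<close> to \<open>i + 1\<close>.\<close>

definition columns :: "real list list \<Rightarrow> bool" where
  "columns cs \<longleftrightarrow> (\<forall>c\<in>set cs. sorted_wrt (<) c) \<and>
     (\<forall>y i j k. i < j \<longrightarrow> j < k \<longrightarrow> k < length cs \<longrightarrow> y \<in> set (cs ! i) \<longrightarrow> y \<in> set (cs ! k) \<longrightarrow> y \<in> set (cs ! j))"

lemma fresh_between:
  fixes xs zs :: "real list"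
  assumes "finite F" "sorted_wrt (<) (xs @ zs)"
  shows "\<exists>ys. length ys = n \<and> sorted_wrt (<) (xs @ ys @ zs) \<and> set ys \<inter> F = {}"
  using assms(2)
proof (induction n arbitrary: xs)
  case (Suc n)
  \<comment> \<open>The inserted element keeps \<open>Max\<close> meaningful for empty
    \<open>xs\<close> and lies below all of \<open>zs\<close>; likewise \<open>l + 1\<close> keeps
    \<open>Min\<close> meaningful in \<open>u\<close>.\<close>
  define l where "l = Max (insert (Min (insert 0 (set zs)) - 1) (set xs))"
  define u where "u = Min (insert (l + 1) (set zs))"
  have "Min (insert 0 (set zs)) \<le> z" if "z \<in> set zs" for z
    using that by (intro Min_le) auto
  then have "Min (insert 0 (set zs)) - 1 < z" if "z \<in> set zs" for z
    using \<open>\<And>z. z \<in> set zs \<Longrightarrow> Min (insert 0 (set zs)) \<le> z\<close>[OF that] by linarith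
  then have "l < z" if "z \<in> set zs" for z
    using that Suc.prems unfolding l_def by (subst Max_less_iff) (auto simp: sorted_wrt_append)
  then have "l < u"
    unfolding u_def by (subst Min_gr_iff) auto
  then have "infinite ({l<..<u} - F)"
    using assms(1) by (simp add: Diff_infinite_finite infinite_Ioo)
  then obtain y where y: "l < y" "y < u" "y \<notin> F"
    by (metis DiffE finite.emptyI greaterThanLessThan_iff ex_in_conv)
  have "x < y" if "x \<in> set xs" for x
    using y(1) that unfolding l_def by (subst (asm) Max_less_iff) auto
  moreover have "y < z" if "z \<in> set zs" for z
    using y(2) that unfolding u_def by (subst (asm) Min_gr_iff) auto
  ultimately have "sorted_wrt (<) ((xs @ [y]) @ zs)"
    using Suc.prems by (auto simp: sorted_wrt_append)
  from Suc.IH[OF this] obtain ys where "length ys = n" "sorted_wrt (<) (xs @ y # ys @ zs)" "set ys \<inter> F = {}"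
    by auto
  then show ?case
    using y(3) by (intro exI[of _ "y # ys"]) auto
qed auto

text \<open>Each move contributes one column. Kept letters keep their heights and new letters
  receive heights outside \<open>F\<close>, so a height that has disappeared never returns; this
  gives the convexity required by \<open>columns\<close>. The first column has no predecessor,
  whence the cases on \<open>cs = []\<close>.\<close>

lemma game_columns:
  assumes "game w M S"
  shows "\<exists>cs lab. columns cs \<and> (cs = [] \<longrightarrow> w = []) \<and> (cs \<noteq> [] \<longrightarrow> map lab (last cs) = w) \<and>
    (\<forall>c\<in>set cs. alternating (map lab c)) \<and> S = (\<Union>c\<in>set cs. adj (map lab c)) \<and>
    M = image_mset lab (mset_set (\<Union>c\<in>set cs. set c))"
  using assms
proof (induction rule: game.induct)
  case start
  show ?case
    by (intro exI[of _ "[]"] exI[of _ "\<lambda>_. undefined"]) (auto simp: columns_def)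
next
  case (move xs as ys M S bs)
  from move.IH obtain cs lab where cs: "columns cs" "cs = [] \<longrightarrow> xs @ as @ ys = []"
    "cs \<noteq> [] \<longrightarrow> map lab (last cs) = xs @ as @ ys" "\<forall>c\<in>set cs. alternating (map lab c)"
    "S = (\<Union>c\<in>set cs. adj (map lab c))" "M = image_mset lab (mset_set (\<Union>c\<in>set cs. set c))"
    by blast
  define F where "F = (\<Union>c\<in>set cs. set c)"
  have F: "finite F"
    by (simp add: F_def)
  define c where "c = (if cs = [] then [] else last cs)"
  have c: "map lab c = xs @ as @ ys" "set c \<subseteq> F" "sorted_wrt (<) c"
    using cs(1-3) by (auto simp: c_def F_def columns_def intro!: bexI[of _ "last cs"])
  define X A Y where "X = take (length xs) c" and "A = take (length as) (drop (length xs) c)"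
    and "Y = drop (length as) (drop (length xs) c)"
  then have XAY: "c = X @ A @ Y" "map lab X = xs" "map lab Y = ys"
    by (simp_all only: append_take_drop_id c(1) flip: take_map drop_map) simp_all
  then have "sorted_wrt (<) (X @ Y)"
    using c(3) by (auto simp: sorted_wrt_append)
  from fresh_between[OF F this, of "length bs"] obtain B where
    B: "length B = length bs" "sorted_wrt (<) (X @ B @ Y)" "set B \<inter> F = {}"
    by blast
  define lab' where "lab' y = (case map_of (zip B bs) y of Some b \<Rightarrow> b | None \<Rightarrow> lab y)" for y
  have old: "lab' y = lab y" if "y \<in> F" for y
  proof -
    have "map_of (zip B bs) y = None"
      using that B(1,3) by (auto simp: map_of_zip_is_None)
    then show ?thesis
      by (simp add: lab'_def)
  qed
  have dist: "distinct B"
    using B(2) by (simp add: sorted_wrt_append strict_sorted_iff)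
  have new: "map lab' B = bs"
    using B(1) by (intro nth_equalityI) (auto simp: lab'_def map_of_zip_nth[OF B(1) dist])
  have old_map: "map lab' d = map lab d" if "set d \<subseteq> F" for d
    using that old by auto
  have XY: "set X \<subseteq> F" "set Y \<subseteq> F"
    using c(2) XAY(1) by auto
  define c' where "c' = X @ B @ Y"
  have c': "map lab' c' = xs @ bs @ ys"
    unfolding c'_def using new XAY XY by (simp add: old_map)
  have csF: "set d \<subseteq> F" if "d \<in> set cs" for d
    using that by (auto simp: F_def)
  have "columns (cs @ [c'])"
    unfolding columns_def
  proof (intro conjI allI impI)
    show "\<forall>c\<in>set (cs @ [c']). sorted_wrt (<) c"
      using cs(1) B(2) by (auto simp: columns_def c'_def)
    fix y i j k
    assume ijk: "i < j" "j < k" "k < length (cs @ [c'])" and y: "y \<in> set ((cs @ [c']) ! i)" "y \<in> set ((cs @ [c']) ! k)"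
    then have j: "j < length cs" "cs \<noteq> []" and yi: "y \<in> set (cs ! i)" and i: "i < length cs"
      by (auto simp: nth_append)
    show "y \<in> set ((cs @ [c']) ! j)"
    proof (cases "k < length cs")
      case True
      then show ?thesis
        using cs(1) ijk y j by (auto simp: columns_def nth_append)
    next
      case False
      then have "y \<in> set c'"
        using ijk y by (auto simp: nth_append)
      moreover have "y \<in> F"
        using csF[OF nth_mem[OF i]] yi by auto
      ultimately have "y \<in> set (last cs)"
        using B(3) XAY(1) j(2) by (auto simp: c'_def c_def)
      then have y_last: "y \<in> set (cs ! (length cs - 1))"
        using j by (simp add: last_conv_nth)
      have "y \<in> set (cs ! j)"
      proof (cases "j = length cs - 1")
        case False
        then have "j < length cs - 1" "length cs - 1 < length cs"
          using j by auto
        then show ?thesis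
          using cs(1) ijk(1) yi y_last unfolding columns_def by blast
      qed (use y_last in simp)
      then show ?thesis
        using j by (simp add: nth_append)
    qed
  qed
  moreover have "(\<Union>c\<in>set cs. adj (map lab' c)) = (\<Union>c\<in>set cs. adj (map lab c))"
    by (rule SUP_cong[OF refl]) (simp only: old_map[OF csF])
  then have "S \<union> adj (xs @ bs @ ys) = (\<Union>c\<in>set (cs @ [c']). adj (map lab' c))"
    using cs(5) c' by (simp add: Un_commute)
  moreover have "M + mset bs = image_mset lab' (mset_set (\<Union>c\<in>set (cs @ [c']). set c))"
  proof -
    have "(\<Union>c\<in>set (cs @ [c']). set c) = F \<union> set B"
      using XY by (auto simp: F_def c'_def)
    moreover have "mset_set (F \<union> set B) = mset_set F + mset_set (set B)"
      using F B(3) by (intro mset_set_Union) auto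
    moreover have "image_mset lab' (mset_set F) = image_mset lab (mset_set F)"
      by (intro image_mset_cong) (use old F in auto)
    moreover have "image_mset lab' (mset_set (set B)) = mset bs"
      using dist new by (metis mset_map mset_set_set)
    ultimately show ?thesis
      using cs(6) by (simp add: F_def)
  qed
  moreover have "\<forall>c\<in>set (cs @ [c']). alternating (map lab' c)"
  proof
    fix d assume "d \<in> set (cs @ [c'])"
    show "alternating (map lab' d)"
    proof (cases "d \<in> set cs")
      case True
      then show ?thesis
        unfolding old_map[OF csF[OF True]] using cs(4) by blast
    next
      case False
      then have "d = c'"
        using \<open>d \<in> set (cs @ [c'])\<close> by simp
      then show ?thesis
        using c' move.hyps(2) by simp
    qed
  qed
  ultimately show ?case
    using c' by (intro exI[of _ "cs @ [c']"] exI[of _ lab']) auto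
qed

section \<open>From columns to bars with integer ends\<close>

definition bar :: "real list list \<Rightarrow> real \<Rightarrow> (real \<times> real) set" where
  "bar cs y = {real (Min {i. i < length cs \<and> y \<in> set (cs ! i)})..
     real (Suc (Max {i. i < length cs \<and> y \<in> set (cs ! i)}))} \<times> {y}"

context
  fixes cs :: "real list list" and Y l r
  assumes cs: "columns cs"
  defines "Y \<equiv> \<Union>c\<in>set cs. set c"
    and "l \<equiv> \<lambda>y. Min {i. i < length cs \<and> y \<in> set (cs ! i)}"
    and "r \<equiv> \<lambda>y. Suc (Max {i. i < length cs \<and> y \<in> set (cs ! i)})"
begin

lemma bar_eq: "bar cs y = {real (l y)..real (r y)} \<times> {y}"
  by (simp add: bar_def l_def r_def)

lemma mem_Y: "y \<in> Y \<longleftrightarrow> (\<exists>i<length cs. y \<in> set (cs ! i))"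
  by (auto simp: Y_def set_conv_nth[of cs])

lemma mem_column_iff:
  assumes "y \<in> Y"
  shows "i < length cs \<and> y \<in> set (cs ! i) \<longleftrightarrow> l y \<le> i \<and> i < r y"
proof -
  let ?I = "{i. i < length cs \<and> y \<in> set (cs ! i)}"
  have fin: "finite ?I"
    by simp
  have ne: "?I \<noteq> {}"
    using assms by (auto simp: mem_Y)
  have lI: "l y \<in> ?I" and rI: "Max ?I \<in> ?I"
    using Min_in[OF fin ne] Max_in[OF fin ne] by (auto simp: l_def)
  show ?thesis
  proof
    assume "i < length cs \<and> y \<in> set (cs ! i)"
    then have "i \<in> ?I"
      by simp
    from Min_le[OF fin this] Max_ge[OF fin this] show "l y \<le> i \<and> i < r y"
      by (simp add: l_def r_def)
  next
    assume i: "l y \<le> i \<and> i < r y"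
    then have le: "i \<le> Max ?I"
      by (simp add: r_def)
    consider "i = l y" | "i = Max ?I" | "l y < i" "i < Max ?I"
      using i le by linarith
    then show "i < length cs \<and> y \<in> set (cs ! i)"
    proof cases
      case 3
      then show ?thesis
        using cs lI rI unfolding columns_def by auto
    qed (use lI rI in auto)
  qed
qed

lemma l_less_r:
  assumes "y \<in> Y"
  shows "l y < r y"
proof -
  obtain i where "i < length cs \<and> y \<in> set (cs ! i)"
    using assms by (auto simp: mem_Y)
  then show ?thesis
    unfolding mem_column_iff[OF assms] by simp
qed

lemma is_bar_bar: "y \<in> Y \<Longrightarrow> is_bar (bar cs y)"
  unfolding is_bar_def bar_eq using l_less_r by (intro exI conjI) auto

lemma bar_disjoint: "y \<noteq> z \<Longrightarrow> bar cs y \<inter> bar cs z = {}"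
  by (auto simp: bar_eq)

lemma inj_on_bar: "inj_on (bar cs) Y"
proof (rule inj_onI)
  fix y z assume y: "y \<in> Y" "z \<in> Y" "bar cs y = bar cs z"
  have "(real (l y), y) \<in> bar cs y"
    using l_less_r[OF y(1)] by (simp add: bar_eq)
  then show "y = z"
    unfolding y(3) by (simp add: bar_eq)
qed

text \<open>All ends are integers, so the set of bars met by a vertical line is constant over the
  interior of a column. A channel can be examined inside one column, and conversely consecutive
  heights in a column leave its full width free.\<close>

lemma channel_bar:
  assumes "y \<in> Y" "z \<in> Y"
  shows "channel (bar cs ` Y) (bar cs y) (bar cs z) \<longleftrightarrow> (\<exists>c\<in>set cs. (y, z) \<in> consec c)"
proof
  assume "channel (bar cs ` Y) (bar cs y) (bar cs z)"
  then obtain a b c d where ab: "a < b" "c < d" "{a..b} \<times> {c} \<subseteq> bar cs y" "{a..b} \<times> {d} \<subseteq> bar cs z"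
    "\<forall>B \<in> bar cs ` Y - {bar cs y, bar cs z}. ({a<..<b} \<times> {c<..<d}) \<inter> B = {}"
    unfolding channel_def by blast
  have "(a, c) \<in> bar cs y" "(b, c) \<in> bar cs y" "(a, d) \<in> bar cs z" "(b, d) \<in> bar cs z"
    using ab(1,3,4) by auto
  then have y: "c = y" "real (l y) \<le> a" "b \<le> real (r y)" and z: "d = z" "real (l z) \<le> a" "b \<le> real (r z)"
    by (auto simp: bar_eq)
  define i where "i = nat \<lfloor>a\<rfloor>"
  have "0 \<le> a"
    using y(2) by simp
  then have i: "real i \<le> a" "a < real i + 1"
    by (simp_all add: i_def)
  have "l y \<le> i" "l z \<le> i"
    using y(2) z(2) \<open>0 \<le> a\<close> by (simp_all add: i_def le_nat_floor)
  moreover have "i < r y" "i < r z"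
    using i(1) ab(1) y(3) z(3) by linarith+
  ultimately have yz: "i < length cs" "y \<in> set (cs ! i)" "z \<in> set (cs ! i)"
    using mem_column_iff[OF assms(1)] mem_column_iff[OF assms(2)] by blast+
  have "\<not> (y < x \<and> x < z)" if x: "x \<in> set (cs ! i)" for x
  proof
    assume yxz: "y < x \<and> x < z"
    have xY: "x \<in> Y"
      using x yz(1) by (auto simp: Y_def)
    then have "l x \<le> i" "i < r x"
      using mem_column_iff x yz(1) by blast+
    \<comment> \<open>The midpoint of the part of the channel that lies in column \<open>i\<close>;
      any bar of this column covers it.\<close>
    define p where "p = (a + min b (real i + 1)) / 2"
    have p: "a < p" "p < b" "p < real i + 1"
      using ab(1) i by (auto simp: p_def min_def)
    then have "real (l x) \<le> p" "p \<le> real (r x)"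
      using \<open>l x \<le> i\<close> \<open>i < r x\<close> i(1) by linarith+
    then have "(p, x) \<in> bar cs x"
      by (simp add: bar_eq)
    moreover have "(p, x) \<in> {a<..<b} \<times> {c<..<d}"
      using p yxz y(1) z(1) by simp
    moreover have "bar cs x \<in> bar cs ` Y - {bar cs y, bar cs z}"
      using xY yxz assms inj_on_bar by (auto dest: inj_onD)
    ultimately show False
      using ab(5) by blast
  qed
  moreover have "sorted_wrt (<) (cs ! i)"
    using cs yz(1) by (simp add: columns_def)
  ultimately have "(y, z) \<in> consec (cs ! i)"
    using yz ab(2) y(1) z(1) by (simp add: consec_sorted)
  then show "\<exists>c\<in>set cs. (y, z) \<in> consec c"
    using yz(1) by auto
next
  assume "\<exists>c\<in>set cs. (y, z) \<in> consec c"
  then obtain i where i: "i < length cs" "(y, z) \<in> consec (cs ! i)"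
    by (auto simp: in_set_conv_nth)
  moreover have "sorted_wrt (<) (cs ! i)"
    using cs i(1) by (simp add: columns_def)
  ultimately have yz: "y \<in> set (cs ! i)" "z \<in> set (cs ! i)" "y < z" "\<And>x. x \<in> set (cs ! i) \<Longrightarrow> \<not> (y < x \<and> x < z)"
    by (auto simp: consec_sorted)
  have ir: "l y \<le> i" "i < r y" "l z \<le> i" "i < r z"
    using mem_column_iff assms yz i(1) by blast+
  show "channel (bar cs ` Y) (bar cs y) (bar cs z)"
    unfolding channel_def
  proof (intro exI conjI ballI)
    show "real i < real (Suc i)" "y < z"
      using yz by auto
    show "{real i..real (Suc i)} \<times> {y} \<subseteq> bar cs y" "{real i..real (Suc i)} \<times> {z} \<subseteq> bar cs z"
      using ir by (auto simp: bar_eq)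
    fix B assume "B \<in> bar cs ` Y - {bar cs y, bar cs z}"
    then obtain x where x: "x \<in> Y" "B = bar cs x"
      by auto
    have False if p: "p \<in> {real i<..<real (Suc i)} \<times> {y<..<z} \<inter> B" for p
    proof -
      from p x(2) have "real i < fst p" "fst p < real (Suc i)" "real (l x) \<le> fst p" "fst p \<le> real (r x)"
        "y < x" "x < z"
        by (auto simp: bar_eq)
      \<comment> \<open>Here integrality is used: a bar that meets the open interval from
        \<open>i\<close> to \<open>i + 1\<close> spans all of it.\<close>
      then have "l x \<le> i" "i < r x"
        by linarith+
      then have "x \<in> set (cs ! i)"
        using mem_column_iff[OF x(1)] by blast
      then show False
        using yz(4) \<open>y < x\<close> \<open>x < z\<close> by blast
    qed
    then show "{real i<..<real (Suc i)} \<times> {y<..<z} \<inter> B = {}"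
      by blast
  qed
qed

end

lemma drawable_rep:
  fixes G :: "('a, 'b) pre_digraph"
  assumes "drawable t m n" "complete_bipartite_digraph m n G" "0 < m" "0 < n"
  shows "\<exists>\<beta>. bar_visibility_rep t G \<beta>"
proof -
  obtain U V where G: "verts G = U \<union> V" "U \<inter> V = {}" "card U = m" "card V = n"
      "arcs_ends G = U \<times> V \<union> V \<times> U"
    using assms(2) unfolding complete_bipartite_digraph_def by auto
  have fin: "finite U" "finite V"
    using G(3,4) assms(3,4) by (simp_all add: card_ge_0_finite)
  obtain f where f: "bij_betw f U {..<m}"
    using ex_bij_betw_finite_nat[OF fin(1)] G(3) by (auto simp: atLeast0LessThan)
  obtain g where g: "bij_betw g V {..<n}"
    using ex_bij_betw_finite_nat[OF fin(2)] G(4) by (auto simp: atLeast0LessThan)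
  define p where "p v = (if v \<in> U then Inl (f v) else Inr (g v) :: nat + nat)" for v
  have pV: "p v = Inr (g v)" if "v \<in> V" for v
    using that G(2) by (auto simp: p_def)
  have pU: "p u = Inl (f u)" if "u \<in> U" for u
    using that by (auto simp: p_def)
  have p_inj: "inj_on p (verts G)"
    using f g G(1) by (auto simp: bij_betw_def inj_on_def p_def)
  have p_im: "p ` verts G = Inl ` {..<m} \<union> Inr ` {..<n}"
  proof -
    have "p ` U = Inl ` f ` U" "p ` V = Inr ` g ` V"
      using pU pV by (force simp: image_image)+
    then show ?thesis
      using f g by (simp add: G(1) image_Un bij_betw_def)
  qed
  obtain w M S where M: "game w M S" "{..<m} \<times> {..<n} \<subseteq> S" "\<And>x. count M x \<le> t"
      "set_mset M \<subseteq> Inl ` {..<m} \<union> Inr ` {..<n}"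
    using assms(1) unfolding drawable_def reach_def by auto
  from game_columns[OF M(1)] obtain cs lab where cs: "columns cs" "\<And>c. c \<in> set cs \<Longrightarrow> alternating (map lab c)"
    "S = (\<Union>c\<in>set cs. adj (map lab c))" "M = image_mset lab (mset_set (\<Union>c\<in>set cs. set c))"
    by blast
  define Y where "Y = (\<Union>c\<in>set cs. set c)"
  have fY: "finite Y"
    by (simp add: Y_def)
  define \<beta> where "\<beta> v = bar cs ` {y \<in> Y. lab y = p v}" for v
  have all: "(\<Union>v\<in>verts G. \<beta> v) = bar cs ` Y"
  proof -
    have "lab y \<in> p ` verts G" if "y \<in> Y" for y
      using M(4) that fY unfolding p_im cs(4) Y_def by auto
    then show ?thesis
      unfolding \<beta>_def by fastforce
  qed
  have sees: "(\<exists>B\<in>\<beta> u. \<exists>B'\<in>\<beta> v. sees (bar cs ` Y) B B') \<longleftrightarrow>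
      (\<exists>c\<in>set cs. (p u, p v) \<in> consec (map lab c) \<union> (consec (map lab c))\<inverse>)" for u v
  proof -
    have sub: "y \<in> Y \<and> z \<in> Y" if "(y, z) \<in> consec c" "c \<in> set cs" for c y z
      using that cs(1) by (auto simp: Y_def columns_def consec_sorted)
    have iff: "sees (bar cs ` Y) (bar cs y) (bar cs z) \<longleftrightarrow> (\<exists>c\<in>set cs. (y, z) \<in> consec c \<or> (z, y) \<in> consec c)"
      if "y \<in> Y" "z \<in> Y" for y z
      using channel_bar[OF cs(1), folded Y_def, OF that] channel_bar[OF cs(1), folded Y_def, OF that(2,1)]
      unfolding sees_def by blast
    have "(\<exists>B\<in>\<beta> u. \<exists>B'\<in>\<beta> v. sees (bar cs ` Y) B B') \<longleftrightarrow>
        (\<exists>y\<in>Y. \<exists>z\<in>Y. lab y = p u \<and> lab z = p v \<and> sees (bar cs ` Y) (bar cs y) (bar cs z))"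
      unfolding \<beta>_def by blast
    also have "\<dots> \<longleftrightarrow> (\<exists>c\<in>set cs. \<exists>y z. lab y = p u \<and> lab z = p v \<and> ((y, z) \<in> consec c \<or> (z, y) \<in> consec c))"
    proof
      assume "\<exists>y\<in>Y. \<exists>z\<in>Y. lab y = p u \<and> lab z = p v \<and> sees (bar cs ` Y) (bar cs y) (bar cs z)"
      then obtain y z where "y \<in> Y" "z \<in> Y" "lab y = p u" "lab z = p v" "sees (bar cs ` Y) (bar cs y) (bar cs z)"
        by blast
      then show "\<exists>c\<in>set cs. \<exists>y z. lab y = p u \<and> lab z = p v \<and> ((y, z) \<in> consec c \<or> (z, y) \<in> consec c)"
        using iff[of y z] by blast
    next
      assume "\<exists>c\<in>set cs. \<exists>y z. lab y = p u \<and> lab z = p v \<and> ((y, z) \<in> consec c \<or> (z, y) \<in> consec c)"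
      then obtain c y z where c: "c \<in> set cs" "lab y = p u" "lab z = p v" "(y, z) \<in> consec c \<or> (z, y) \<in> consec c"
        by blast
      then have "y \<in> Y" "z \<in> Y"
        using sub by blast+
      moreover from this have "sees (bar cs ` Y) (bar cs y) (bar cs z)"
        using iff c(1,4) by blast
      ultimately show "\<exists>y\<in>Y. \<exists>z\<in>Y. lab y = p u \<and> lab z = p v \<and> sees (bar cs ` Y) (bar cs y) (bar cs z)"
        using c(2,3) by blast
    qed
    also have "\<dots> \<longleftrightarrow> (\<exists>c\<in>set cs. (p u, p v) \<in> consec (map lab c) \<union> (consec (map lab c))\<inverse>)"
    proof (rule bex_cong[OF refl])
      fix c
      have "(a, b) \<in> consec (map lab c) \<longleftrightarrow> (\<exists>y z. lab y = a \<and> lab z = b \<and> (y, z) \<in> consec c)" for a b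
        unfolding consec_map by force
      then show "(\<exists>y z. lab y = p u \<and> lab z = p v \<and> ((y, z) \<in> consec c \<or> (z, y) \<in> consec c)) \<longleftrightarrow>
          (p u, p v) \<in> consec (map lab c) \<union> (consec (map lab c))\<inverse>"
        unfolding Un_iff converse_iff by blast
    qed
    finally show ?thesis .
  qed
  have "bar_visibility_rep t G \<beta>"
    unfolding bar_visibility_rep_def all
  proof (intro conjI ballI impI)
    fix v assume v: "v \<in> verts G"
    show "finite (\<beta> v)"
      using fY by (simp add: \<beta>_def)
    have "card (\<beta> v) \<le> card {y \<in> Y. lab y = p v}"
      unfolding \<beta>_def using fY by (intro card_image_le) auto
    also have "\<dots> = count M (p v)"
      unfolding cs(4) Y_def[symmetric] using fY by (simp add: count_image_mset' Collect_conj_eq Int_commute eq_commute[of "p v"])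
    finally show "card (\<beta> v) \<le> t"
      using M(3)[of "p v"] by simp
    show "is_bar B" if "B \<in> \<beta> v" for B
      using that is_bar_bar[OF cs(1), folded Y_def] by (auto simp: \<beta>_def)
  next
    fix u v B B' assume uv: "u \<in> verts G" "v \<in> verts G" and BB: "B \<in> \<beta> u" "B' \<in> \<beta> v" "(u, B) \<noteq> (v, B')"
    obtain y z where yz: "lab y = p u" "B = bar cs y" "lab z = p v" "B' = bar cs z"
      using BB(1,2) unfolding \<beta>_def by blast
    have "y \<noteq> z"
    proof
      assume "y = z"
      then have "u = v"
        using yz inj_onD[OF p_inj] uv by simp
      then show False
        using BB(3) yz \<open>y = z\<close> by simp
    qed
    then show "B \<inter> B' = {}"
      using bar_disjoint[OF cs(1)] yz by simp
  next
    fix u v assume uv: "u \<in> verts G" "v \<in> verts G" "u \<noteq> v"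
    have opp: "opp (p u) (p v) \<longleftrightarrow> (u, v) \<in> U \<times> V \<union> V \<times> U"
      using uv(1,2) G(1,2) pU pV by auto
    show "u \<rightarrow>\<^bsub>G\<^esub> v \<longleftrightarrow> (\<exists>B\<in>\<beta> u. \<exists>B'\<in>\<beta> v. sees (bar cs ` Y) B B')"
      unfolding sees G(5)
    proof
      assume "(u, v) \<in> U \<times> V \<union> V \<times> U"
      then consider "u \<in> U" "v \<in> V" | "u \<in> V" "v \<in> U"
        by auto
      then show "\<exists>c\<in>set cs. (p u, p v) \<in> consec (map lab c) \<union> (consec (map lab c))\<inverse>"
      proof cases
        case 1
        then have "(f u, g v) \<in> S"
          using M(2) bij_betwE[OF f] bij_betwE[OF g] by blast
        then show ?thesis
          using 1 pU pV by (auto simp: cs(3) adj_def)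
      next
        case 2
        then have "(f v, g u) \<in> S"
          using M(2) bij_betwE[OF f] bij_betwE[OF g] by blast
        then show ?thesis
          using 2 pU pV by (auto simp: cs(3) adj_def)
      qed
    next
      assume "\<exists>c\<in>set cs. (p u, p v) \<in> consec (map lab c) \<union> (consec (map lab c))\<inverse>"
      then obtain c where c: "c \<in> set cs" "(p u, p v) \<in> consec (map lab c) \<or> (p v, p u) \<in> consec (map lab c)"
        by blast
      \<comment> \<open>Alternation of the columns excludes all sightings within one side, including
        those between bars of one vertex.\<close>
      from c(2) have "opp (p u) (p v)"
      proof
        assume "(p v, p u) \<in> consec (map lab c)"
        from consec_successively[OF cs(2)[OF c(1)] this] show ?thesis
          by (simp add: opp_def)
      qed (rule consec_successively[OF cs(2)[OF c(1)]])
      then show "(u, v) \<in> U \<times> V \<union> V \<times> U"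
        unfolding opp .
    qed
  qed
  then show ?thesis
    by blast
qed

section \<open>The sweep bound\<close>

text \<open>Alternation is not demanded here: bars of one vertex may see each other, and ties
  between ends produce intermediate words that belong to no position of the line. The set may thus
  contain pairs that are not really seen, which is harmless for an upper bound.\<close>

inductive sweep :: "('u + 'v) list \<Rightarrow> nat \<Rightarrow> ('u \<times> 'v) set \<Rightarrow> bool" where
  start: "sweep [] 0 {}"
| enter: "sweep (xs @ ys) j S \<Longrightarrow> sweep (xs @ b # ys) (Suc j) (S \<union> adj (xs @ b # ys))"
| leave: "sweep (xs @ b # ys) j S \<Longrightarrow> sweep (xs @ ys) (Suc j) (S \<union> adj (xs @ ys))"

definition change :: "'u + 'v \<Rightarrow> 'u + 'v \<Rightarrow> nat" where
  "change a b = of_bool (opp a b)"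

fun changes :: "('u + 'v) list \<Rightarrow> nat" where
  "changes (x # y # zs) = change x y + changes (y # zs)"
| "changes _ = 0"

lemma changes_append: "changes (xs @ x # y # zs) = changes (xs @ [x]) + change x y + changes (y # zs)"
  by (induction xs rule: induct_list012) auto

lemma adj_append: "adj (xs @ x # y # zs) = adj (xs @ [x]) \<union> adj [x, y] \<union> adj (y # zs)"
  unfolding adj_def consec_append_Cons2 consec.simps by blast

lemma adj_Cons2: "adj (x # y # zs) = adj [x, y] \<union> adj (y # zs)"
  using adj_append[of "[]" x y zs] by (simp add: adj_simps)

lemma adj_pair:
  "adj [Inl u, Inr v] = {(u, v)}" "adj [Inr v, Inl u] = {(u, v)}"
  "adj [Inl u, Inl u'] = {}" "adj [Inr v, Inr v'] = {}"
  by (auto simp: adj_def)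

lemma card_adj_pair: "finite (adj [x, y])" "card (adj [x, y]) = change x y"
  by (cases x; cases y; simp add: adj_pair change_def)+

text \<open>Two of three letters are on the same side, so the three changes sum to 0 or 2. Both
  inner steps of the sweep reduce to this: when \<open>b\<close> enters or leaves between
  \<open>a\<close> and \<open>c\<close>, twice the number of new pairs is at most 2 plus the
  increase of \<open>changes\<close> iff the three changes sum to at most 2.\<close>

lemma change_cases:
  "change a c = 0 \<and> change a b = 0 \<and> change b c = 0 \<or> change a c = 0 \<and> change a b = 1 \<and> change b c = 1 \<or>
   change a c = 1 \<and> change a b = 0 \<and> change b c = 1 \<or> change a c = 1 \<and> change a b = 1 \<and> change b c = 0"
  by (auto simp: change_def opp_def)

lemma change_le: "change a b \<le> 1"
  by (simp add: change_def)

text \<open>If the outermost bars of the word already see each other, removing everything between them wins no new pair.\<close>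

definition ends_seen :: "('u + 'v) list \<Rightarrow> ('u \<times> 'v) set \<Rightarrow> bool" where
  "ends_seen w S \<longleftrightarrow> change (hd w) (last w) = 1 \<and> adj [hd w, last w] \<subseteq> S"

definition deficit :: "('u + 'v) list \<Rightarrow> nat \<Rightarrow> ('u \<times> 'v) set \<Rightarrow> nat \<Rightarrow> bool" where
  "deficit w j S d \<longleftrightarrow> 2 * card S + d \<le> 2 * j + changes w"

text \<open>The deficit starts at 0, is 2 for the first bar and 3 for the first two, and never decreases. In the critical
  case of deficit 3 the two outermost bars have been there from the beginning, so that their pair is counted
  twice. A final deficit of 7 suffices since \<open>2 * card S\<close> is even.\<close>

definition sweep_inv :: "('u + 'v) list \<Rightarrow> nat \<Rightarrow> ('u \<times> 'v) set \<Rightarrow> bool" where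
  "sweep_inv w j S \<longleftrightarrow> finite S \<and> adj w \<subseteq> S \<and>
    (w = [] \<longrightarrow> j = 0 \<and> S = {} \<or> deficit w j S (if 5 \<le> j then 7 else if 3 \<le> j then 6 else 4)) \<and>
    (length w = 1 \<longrightarrow> deficit w j S (if 4 \<le> j then 5 else if 2 \<le> j then 4 else 2)) \<and>
    (2 \<le> length w \<longrightarrow> deficit w j S 3 \<and> (deficit w j S 4 \<or> ends_seen w S)) \<and>
    (length w = 2 \<longrightarrow> 3 \<le> j \<longrightarrow> deficit w j S 4)"

lemma sweep_invI:
  assumes "finite S" "adj w \<subseteq> S" "2 \<le> length w" "deficit w j S 4"
  shows "sweep_inv w j S"
  using assms by (auto simp: sweep_inv_def deficit_def)

lemma card_Un_pair: "finite S \<Longrightarrow> card (S \<union> adj [x, y]) \<le> card S + change x y"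
  using card_Un_le[of S "adj [x, y]"] by (simp add: card_adj_pair)

text \<open>Inside the word \<open>change_cases\<close> preserves every deficit. At an end of a
  nonempty word at most one new pair arises, and it also counts as a new change, so the deficit
  grows by at least 1.\<close>

lemma sweep_inv_enter:
  assumes "sweep_inv (xs @ ys) j S"
  shows "sweep_inv (xs @ b # ys) (Suc j) (S \<union> adj (xs @ b # ys))"
proof -
  have fin: "finite S" and sub: "adj (xs @ ys) \<subseteq> S"
    using assms by (auto simp: sweep_inv_def)
  consider "xs = []" "ys = []" | a where "xs = [a]" "ys = []" | a where "xs = []" "ys = [a]"
    | a a' zs where "xs = []" "ys = a # a' # zs" | a a' zs where "xs = zs @ [a', a]" "ys = []"
    | a c us vs where "xs = us @ [a]" "ys = c # vs"
    by (cases ys; cases xs rule: rev_cases; cases "butlast xs" rule: rev_cases; cases "tl ys") auto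
  then show ?thesis
  proof cases
    case 1
    then show ?thesis
      using assms by (auto simp: sweep_inv_def deficit_def adj_simps split: if_splits)
  next
    case (2 a)
    have "card (S \<union> adj [a, b]) \<le> card S + change a b"
      using card_Un_pair[OF fin] .
    then show ?thesis
      using assms change_le[of a b] card_adj_pair(1)[of a b] unfolding 2
      by (cases "change a b") (auto simp: sweep_inv_def deficit_def ends_seen_def adj_simps split: if_splits)
  next
    case (3 a)
    have "card (S \<union> adj [b, a]) \<le> card S + change b a"
      using card_Un_pair[OF fin] .
    then show ?thesis
      using assms change_le[of b a] card_adj_pair(1)[of b a] unfolding 3
      by (cases "change b a") (auto simp: sweep_inv_def deficit_def ends_seen_def adj_simps split: if_splits)
  next
    case (4 a a' zs)
    have S': "S \<union> adj (xs @ b # ys) = S \<union> adj [b, a]"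
      using sub 4 adj_Cons2[of b a "a' # zs"] by auto
    have "card (S \<union> adj [b, a]) \<le> card S + change b a"
      using card_Un_pair[OF fin] .
    moreover have "deficit (xs @ ys) j S 3"
      using assms by (simp add: sweep_inv_def 4)
    ultimately have "deficit (xs @ b # ys) (Suc j) (S \<union> adj [b, a]) 4"
      using change_le[of b a] by (simp add: deficit_def 4)
    then show ?thesis
      unfolding S'[symmetric] by (intro sweep_invI) (simp_all only: S' finite_Un fin card_adj_pair, auto simp: 4 S'[symmetric])
  next
    case (5 a a' zs)
    have S': "S \<union> adj (xs @ b # ys) = S \<union> adj [a, b]"
      using sub 5 adj_append[of "zs @ [a']" a b "[]"] by (auto simp: adj_simps)
    have "card (S \<union> adj [a, b]) \<le> card S + change a b"
      using card_Un_pair[OF fin] .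
    moreover have "deficit (xs @ ys) j S 3"
      using assms by (simp add: sweep_inv_def 5)
    ultimately have "deficit (xs @ b # ys) (Suc j) (S \<union> adj [a, b]) 4"
      using change_le[of a b] changes_append[of "zs @ [a']" a b "[]"] by (simp add: deficit_def 5)
    then show ?thesis
      unfolding S'[symmetric] by (intro sweep_invI) (simp_all only: S' finite_Un fin card_adj_pair, auto simp: 5 S'[symmetric])
  next
    case (6 a c us vs)
    have S': "S \<union> adj (xs @ b # ys) = S \<union> adj [a, b] \<union> adj [b, c]"
      using sub adj_append[of us a b "c # vs"] adj_append[of us a c vs] adj_Cons2[of b c vs] by (auto simp: 6)
    have "card (S \<union> adj [a, b] \<union> adj [b, c]) \<le> card (S \<union> adj [a, b]) + change b c"
      using fin card_adj_pair(1) by (intro card_Un_pair) auto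
    also have "\<dots> \<le> card S + change a b + change b c"
      using card_Un_pair[OF fin, of a b] by simp
    finally have card: "card (S \<union> adj (xs @ b # ys)) \<le> card S + change a b + change b c"
      by (simp add: S')
    have ch: "changes (xs @ b # ys) + change a c = changes (xs @ ys) + change a b + change b c"
      using changes_append[of us a b "c # vs"] changes_append[of us a c vs] by (simp add: 6)
    have def: "deficit (xs @ b # ys) (Suc j) (S \<union> adj (xs @ b # ys)) d" if "deficit (xs @ ys) j S d" for d
      using change_cases[of a c b] that card ch unfolding deficit_def by (elim disjE conjE; simp)
    have ends: "ends_seen (xs @ b # ys) (S \<union> adj (xs @ b # ys))" if "ends_seen (xs @ ys) S"
    proof -
      have "hd (xs @ b # ys) = hd (xs @ ys)" "last (xs @ b # ys) = last (xs @ ys)"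
        by (simp_all add: 6 hd_append)
      then show ?thesis
        using that unfolding ends_seen_def by auto
    qed
    have "deficit (xs @ ys) j S 3" "deficit (xs @ ys) j S 4 \<or> ends_seen (xs @ ys) S"
      using assms by (auto simp: sweep_inv_def 6)
    then have "deficit (xs @ b # ys) (Suc j) (S \<union> adj (xs @ b # ys)) 3"
      "deficit (xs @ b # ys) (Suc j) (S \<union> adj (xs @ b # ys)) 4 \<or> ends_seen (xs @ b # ys) (S \<union> adj (xs @ b # ys))"
      using def ends by blast+
    moreover have "finite (S \<union> adj (xs @ b # ys))"
      unfolding S' using fin card_adj_pair(1) by auto
    moreover have "3 \<le> length (xs @ b # ys)"
      by (simp add: 6)
    ultimately show ?thesis
      unfolding sweep_inv_def by auto
  qed
qed

text \<open>At an end no pair is new and at most one change is lost, so the deficit grows by at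
  least 1. Inside, the bound is that of \<open>change_cases\<close>, except that a word of length 2
  has to reach deficit 4.\<close>

lemma sweep_inv_leave:
  assumes "sweep_inv (xs @ b # ys) j S"
  shows "sweep_inv (xs @ ys) (Suc j) (S \<union> adj (xs @ ys))"
proof -
  have fin: "finite S" and sub: "adj (xs @ b # ys) \<subseteq> S"
    using assms by (auto simp: sweep_inv_def)
  consider "xs = []" "ys = []" | a where "xs = [a]" "ys = []" | a where "xs = []" "ys = [a]"
    | a a' zs where "xs = []" "ys = a # a' # zs" | a a' zs where "xs = zs @ [a', a]" "ys = []"
    | a c us vs where "xs = us @ [a]" "ys = c # vs"
    by (cases ys; cases xs rule: rev_cases; cases "butlast xs" rule: rev_cases; cases "tl ys") auto
  then show ?thesis
  proof cases
    case 1
    then show ?thesis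
      using assms by (auto simp: sweep_inv_def deficit_def adj_simps split: if_splits)
  next
    case (2 a)
    then show ?thesis
      using assms change_le[of a b] by (auto simp: sweep_inv_def deficit_def adj_simps split: if_splits)
  next
    case (3 a)
    then show ?thesis
      using assms change_le[of b a] by (auto simp: sweep_inv_def deficit_def adj_simps split: if_splits)
  next
    case (4 a a' zs)
    have S': "S \<union> adj (xs @ ys) = S"
      using sub 4 adj_Cons2[of b a "a' # zs"] by auto
    have "deficit (xs @ b # ys) j S 3"
      using assms by (simp add: sweep_inv_def 4)
    then have "deficit (xs @ ys) (Suc j) S 4"
      using change_le[of b a] by (simp add: deficit_def 4)
    moreover have "adj (xs @ ys) \<subseteq> S"
      using S' by blast
    ultimately show ?thesis
      unfolding S' using fin by (intro sweep_invI) (simp_all add: 4)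
  next
    case (5 a a' zs)
    have S': "S \<union> adj (xs @ ys) = S"
      using sub 5 adj_append[of "zs @ [a']" a b "[]"] by (auto simp: adj_simps)
    have "deficit (xs @ b # ys) j S 3"
      using assms by (simp add: sweep_inv_def 5)
    then have "deficit (xs @ ys) (Suc j) S 4"
      using change_le[of a b] changes_append[of "zs @ [a']" a b "[]"] by (simp add: deficit_def 5)
    moreover have "adj (xs @ ys) \<subseteq> S"
      using S' by blast
    ultimately show ?thesis
      unfolding S' using fin by (intro sweep_invI) (simp_all add: 5)
  next
    case (6 a c us vs)
    have S': "S \<union> adj (xs @ ys) = S \<union> adj [a, c]"
      using sub adj_append[of us a b "c # vs"] adj_append[of us a c vs] adj_Cons2[of b c vs] by (auto simp: 6)
    have card: "card (S \<union> adj (xs @ ys)) \<le> card S + change a c"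
      unfolding S' by (rule card_Un_pair[OF fin])
    have ch: "changes (xs @ b # ys) + change a c = changes (xs @ ys) + change a b + change b c"
      using changes_append[of us a b "c # vs"] changes_append[of us a c vs] by (simp add: 6)
    have def: "deficit (xs @ ys) (Suc j) (S \<union> adj (xs @ ys)) d" if "deficit (xs @ b # ys) j S d" for d
      using change_cases[of a c b] that card ch unfolding deficit_def by (elim disjE conjE; simp)
    have hl: "hd (xs @ b # ys) = hd (xs @ ys)" "last (xs @ b # ys) = last (xs @ ys)"
      by (simp_all add: 6 hd_append)
    have ends: "ends_seen (xs @ ys) (S \<union> adj (xs @ ys))" if "ends_seen (xs @ b # ys) S"
      using that hl unfolding ends_seen_def by auto
    have old: "deficit (xs @ b # ys) j S 3" "deficit (xs @ b # ys) j S 4 \<or> ends_seen (xs @ b # ys) S"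
      using assms by (auto simp: sweep_inv_def 6)
    \<comment> \<open>With deficit only 3, the two remaining letters are the outer ones, whose pair
      is already in \<open>S\<close>. The step then wins no pair, and the deficit grows by
      2.\<close>
    have "deficit (xs @ ys) (Suc j) (S \<union> adj (xs @ ys)) 4" if "length (xs @ ys) = 2"
    proof (cases "deficit (xs @ b # ys) j S 4")
      case False
      then have "change a c = 1" "adj [a, c] \<subseteq> S"
        using old(2) that by (auto simp: ends_seen_def 6)
      then have "S \<union> adj (xs @ ys) = S"
        using S' by auto
      then show ?thesis
        using old(1) ch change_cases[of a c b] \<open>change a c = 1\<close> unfolding deficit_def by auto
    qed (rule def)
    moreover have "deficit (xs @ ys) (Suc j) (S \<union> adj (xs @ ys)) 3"
      "deficit (xs @ ys) (Suc j) (S \<union> adj (xs @ ys)) 4 \<or> ends_seen (xs @ ys) (S \<union> adj (xs @ ys))"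
      using def ends old by blast+
    moreover have "finite (S \<union> adj (xs @ ys))"
      unfolding S' using fin card_adj_pair(1) by auto
    moreover have "2 \<le> length (xs @ ys)"
      by (simp add: 6)
    ultimately show ?thesis
      unfolding sweep_inv_def by auto
  qed
qed

lemma sweep_invariant: "sweep w j S \<Longrightarrow> sweep_inv w j S"
proof (induction rule: sweep.induct)
  case start
  show ?case
    by (simp add: sweep_inv_def adj_simps)
qed (auto intro: sweep_inv_enter sweep_inv_leave)

lemma sweep_card:
  assumes "sweep [] (2 * N) S" "3 \<le> N"
  shows "finite S" "card S + 4 \<le> 2 * N"
  using sweep_invariant[OF assms(1)] assms(2) by (auto simp: sweep_inv_def deficit_def)

section \<open>From a representation to a sweep\<close>

lemma consec_set: "(a, b) \<in> consec w \<Longrightarrow> a \<in> set w \<and> b \<in> set w"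
  by (induction w rule: consec.induct) auto

lemma consec_by_height:
  fixes h :: "'a \<Rightarrow> real"
  assumes "sorted_wrt (<) (map h w)" "a \<in> set w" "b \<in> set w" "h a < h b"
    "\<And>z. z \<in> set w \<Longrightarrow> \<not> (h a < h z \<and> h z < h b)"
  shows "(a, b) \<in> consec w"
proof -
  have "(h a, h b) \<in> consec (map h w)"
    using assms by (simp add: consec_sorted)
  then obtain a' b' where ab: "(a', b') \<in> consec w" "h a' = h a" "h b' = h b"
    by (auto simp: consec_map)
  have "inj_on h (set w)"
    using assms(1) by (simp add: strict_sorted_iff distinct_map)
  then have "a' = a" "b' = b"
    using ab consec_set[OF ab(1)] assms(2,3) by (auto dest: inj_onD)
  then show ?thesis
    using ab(1) by simp
qed

lemma sorted_insert_split:
  fixes h :: "'a \<Rightarrow> real"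
  assumes "sorted_wrt (<) (map h w)" "h x \<notin> h ` set w"
  shows "\<exists>xs ys. w = xs @ ys \<and> sorted_wrt (<) (map h (xs @ x # ys))"
  using assms
proof (induction w)
  case Nil
  then show ?case
    by (intro exI[of _ "[]"]) auto
next
  case (Cons a w)
  show ?case
  proof (cases "h x < h a")
    case True
    then show ?thesis
      using Cons.prems by (intro exI[of _ "[]"] exI[of _ "a # w"]) (auto intro: less_trans)
  next
    case False
    then have xa: "h a < h x"
      using Cons.prems(2) by auto
    obtain xs ys where w: "w = xs @ ys" "sorted_wrt (<) (map h (xs @ x # ys))"
      using Cons by auto
    then show ?thesis
      using Cons.prems(1) xa by (intro exI[of _ "a # xs"] exI[of _ ys]) auto
  qed
qed

text \<open>The ends of bars are treated one at a time, ordered by their first coordinate; ties may be broken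
  arbitrarily since disjoint bars at the same height have no common end. The proof is by induction on sets of
  ends that are closed downwards.\<close>

lemma sweep_exists:
  fixes X :: "('u + 'v) set" and l r h :: "'u + 'v \<Rightarrow> real"
  defines "active \<tau> \<equiv> {x \<in> X. l x < \<tau> \<and> \<tau> \<le> r x}"
  assumes fin: "finite X" and lr: "\<And>x. x \<in> X \<Longrightarrow> l x < r x"
    and disj: "\<And>x y. x \<in> X \<Longrightarrow> y \<in> X \<Longrightarrow> x \<noteq> y \<Longrightarrow> h x = h y \<Longrightarrow> r x < l y \<or> r y < l x"
  shows "\<exists>S. sweep [] (2 * card X) S \<and> (\<forall>\<tau> u v. Inl u \<in> active \<tau> \<longrightarrow> Inr v \<in> active \<tau> \<longrightarrow>
    (\<forall>z\<in>active \<tau>. \<not> (h (Inl u) < h z \<and> h z < h (Inr v)) \<and> \<not> (h (Inr v) < h z \<and> h z < h (Inl u))) \<longrightarrow>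
    (u, v) \<in> S)"
proof -
  define near where "near \<tau> u v \<longleftrightarrow> Inl u \<in> active \<tau> \<and> Inr v \<in> active \<tau> \<and>
    (\<forall>z\<in>active \<tau>. \<not> (h (Inl u) < h z \<and> h z < h (Inr v)) \<and> \<not> (h (Inr v) < h z \<and> h z < h (Inl u)))" for \<tau> u v
  define E :: "(('u + 'v) \<times> bool) set" where "E = X \<times> UNIV"
  define time where "time e = (if snd e then r (fst e) else l (fst e))" for e :: "('u + 'v) \<times> bool"
  define A where "A P = {x. (x, False) \<in> P \<and> (x, True) \<notin> P}" for P :: "(('u + 'v) \<times> bool) set"
  have "\<exists>w S. sweep w (card P) S \<and> sorted_wrt (<) (map h w) \<and> set w = A P \<and>
      (\<forall>\<tau> u v. {e \<in> E. time e < \<tau>} \<subseteq> P \<longrightarrow> near \<tau> u v \<longrightarrow> (u, v) \<in> S)"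
    if "P \<subseteq> E" "\<forall>e\<in>P. \<forall>e'\<in>E. time e' < time e \<longrightarrow> e' \<in> P" for P
    using that
  proof (induction "card P" arbitrary: P)
    case 0
    then have "P = {}"
      using fin finite_subset[of P E] by (simp add: E_def)
    have "\<not> near \<tau> u v" if "{e \<in> E. time e < \<tau>} \<subseteq> P" for \<tau> u v
    proof
      assume "near \<tau> u v"
      then have "(Inl u, False) \<in> {e \<in> E. time e < \<tau>}"
        by (simp add: near_def active_def E_def time_def)
      then show False
        using that \<open>P = {}\<close> by blast
    qed
    then show ?case
      using \<open>P = {}\<close> by (intro exI[of _ "[]"] exI[of _ "{}"]) (auto simp: A_def sweep.start)
  next
    case (Suc k)
    have finP: "finite P" and neP: "P \<noteq> {}"
      using Suc.hyps(2) card.infinite by fastforce+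
    have "Max (time ` P) \<in> time ` P"
      using finP neP by (intro Max_in) auto
    then obtain e where eP: "e \<in> P" and e: "time e = Max (time ` P)"
      by (metis imageE)
    have e_max: "time e' \<le> time e" if "e' \<in> P" for e'
      using that finP unfolding e by (intro Max_ge) auto
    define P' where "P' = P - {e}"
    have P': "P = insert e P'" "e \<notin> P'"
      using eP by (auto simp: P'_def)
    have "k = card P'" "P' \<subseteq> E"
      using Suc.hyps(2) Suc.prems(1) eP finP by (auto simp: P'_def)
    moreover have "\<forall>a\<in>P'. \<forall>e'\<in>E. time e' < time a \<longrightarrow> e' \<in> P'"
      using Suc.prems(2) e_max unfolding P'_def by (metis Diff_iff linorder_not_less singletonD singletonI)
    ultimately obtain w S where w: "sweep w k S" "sorted_wrt (<) (map h w)" "set w = A P'"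
        "\<And>\<tau> u v. {e \<in> E. time e < \<tau>} \<subseteq> P' \<Longrightarrow> near \<tau> u v \<Longrightarrow> (u, v) \<in> S"
      using Suc.hyps(1)[of P'] by blast
    \<comment> \<open>Of two disjoint bars at one height, one ends before the other begins. Since
      \<open>P\<close> is closed downwards, the end of the former is in \<open>P\<close> once the
      start of the latter is, so the two are never in the word together.\<close>
    have heights: "x = y" if "x \<in> A P" "y \<in> A P" "h x = h y" for x y
    proof (rule ccontr)
      assume "x \<noteq> y"
      have no: "\<not> r a < l b" if "a \<in> A P" "b \<in> A P" for a b
      proof
        assume "r a < l b"
        moreover have "(b, False) \<in> P" "(a, True) \<in> E" "(a, True) \<notin> P"
          using that Suc.prems(1) by (auto simp: A_def E_def)
        ultimately show False
          using Suc.prems(2) by (force simp: time_def)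
      qed
      have "x \<in> X" "y \<in> X"
        using that(1,2) Suc.prems(1) by (auto simp: A_def E_def)
      then show False
        using disj[of x y] \<open>x \<noteq> y\<close> that no by blast
    qed
    obtain x b where e: "e = (x, b)"
      by (cases e)
    have xX: "x \<in> X"
      using eP Suc.prems(1) e by (auto simp: E_def)
    obtain w' where w': "sweep w' (Suc k) (S \<union> adj w')" "sorted_wrt (<) (map h w')" "set w' = A P"
    proof (cases b)
      case False
      have "(x, True) \<notin> P"
        using e_max[of "(x, True)"] lr[OF xX] by (auto simp: e False time_def)
      then have AP: "A P = insert x (A P')" "x \<notin> A P'"
        using P' unfolding e False by (auto simp: A_def)
      have "h x \<notin> h ` set w"
        using heights[of x] AP w(3) by force
      from sorted_insert_split[OF w(2) this] obtain xs ys where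
        xs: "w = xs @ ys" "sorted_wrt (<) (map h (xs @ x # ys))"
        by blast
      have "set (xs @ x # ys) = A P"
        using w(3) AP xs(1) by auto
      then show thesis
        using sweep.enter[of xs ys k S x] w(1) xs that by metis
    next
      case True
      have "time (x, False) < time e" "(x, False) \<in> E"
        using lr[OF xX] xX by (auto simp: e True time_def E_def)
      then have "(x, False) \<in> P"
        using Suc.prems(2) eP by blast
      moreover have e': "e = (x, True)"
        using e True by simp
      ultimately have "x \<in> A P'"
        unfolding A_def P'_def by simp
      have AP: "A P = A P' - {x}"
        using eP unfolding A_def P'_def e' by blast
      have "x \<in> set w"
        using w(3) \<open>x \<in> A P'\<close> by simp
      then obtain xs ys where xs: "w = xs @ x # ys"
        by (auto dest: split_list)
      have "distinct w"
        using w(2) by (simp add: strict_sorted_iff distinct_map)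
      then have "set (xs @ ys) = A P"
        using AP w(3) by (auto simp: xs)
      moreover have "sorted_wrt (<) (map h (xs @ ys))"
        using w(2) by (auto simp: xs sorted_wrt_append)
      ultimately show thesis
        using sweep.leave[of xs x ys k S] w(1) xs that by metis
    qed
    have "(u, v) \<in> S \<union> adj w'" if "{e \<in> E. time e < \<tau>} \<subseteq> P" "near \<tau> u v" for \<tau> u v
    proof (cases "{e \<in> E. time e < \<tau>} \<subseteq> P'")
      case True
      then show ?thesis
        using w(4) that(2) by blast
    next
      case False
      then have "time e < \<tau>"
        using that(1) P' by auto
      \<comment> \<open>The last event \<open>e\<close> precedes \<open>\<tau>\<close>, so
        \<open>P\<close> consists of all events before \<open>\<tau>\<close>. The half-open
        condition in \<open>active\<close> fits the strict inequality, and the current word lists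
        exactly \<open>active \<tau>\<close>.\<close>
      then have P: "P = {e \<in> E. time e < \<tau>}"
        using that(1) Suc.prems(1) e_max by fastforce
      have AP: "A P = active \<tau>"
        unfolding P A_def active_def E_def time_def using lr by auto
      have uv: "Inl u \<in> set w'" "Inr v \<in> set w'"
        "\<And>z. z \<in> set w' \<Longrightarrow> \<not> (h (Inl u) < h z \<and> h z < h (Inr v))"
        "\<And>z. z \<in> set w' \<Longrightarrow> \<not> (h (Inr v) < h z \<and> h z < h (Inl u))"
        using that(2) unfolding near_def w'(3) AP by blast+
      have "h (Inl u) \<noteq> h (Inr v)"
        using heights[of "Inl u" "Inr v"] uv(1,2) unfolding w'(3) by blast
      then have "(Inl u, Inr v) \<in> consec w' \<or> (Inr v, Inl u) \<in> consec w'"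
        using consec_by_height[OF w'(2) uv(1,2) _ uv(3)] consec_by_height[OF w'(2) uv(2,1) _ uv(4)]
        by (meson linorder_neqE)
      then show ?thesis
        by (auto simp: adj_def)
    qed
    then show ?case
      using w' Suc.hyps(2) by (intro exI[of _ w'] exI[of _ "S \<union> adj w'"]) auto
  qed
  from this[of E] obtain w S where w: "sweep w (card E) S" "set w = A E"
      "\<And>\<tau> u v. near \<tau> u v \<Longrightarrow> (u, v) \<in> S"
    by auto
  have "A E = {}"
    by (auto simp: A_def E_def)
  then have "w = []"
    using w(2) by simp
  moreover have "card E = 2 * card X"
    by (simp add: E_def card_cartesian_product)
  ultimately show ?thesis
    using w(1,3) unfolding near_def by auto
qed

text \<open>Every edge of the graph is charged to a seen pair of bars. Disjointness gives each bar a
  single owner, so the charging is injective, and \<open>sweep_card\<close> bounds the pairs for at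
  most \<open>t * (m + n)\<close> bars.\<close>

lemma rep_bound:
  fixes G :: "('a, 'b) pre_digraph"
  assumes rep: "bar_visibility_rep t G \<beta>" and G: "complete_bipartite_digraph m n G"
    and mn: "0 < m" "0 < n" "(m, n) \<noteq> (1, 1)"
  shows "m * n + 4 \<le> 2 * t * (m + n)"
proof -
  obtain U V where UV: "verts G = U \<union> V" "U \<inter> V = {}" "card U = m" "card V = n"
      "arcs_ends G = U \<times> V \<union> V \<times> U"
    using G unfolding complete_bipartite_digraph_def by auto
  have fin: "finite U" "finite V"
    using UV(3,4) mn(1,2) by (simp_all add: card_ge_0_finite)
  note rep1 = rep[unfolded bar_visibility_rep_def, THEN conjunct1]
    and rep2 = rep[unfolded bar_visibility_rep_def, THEN conjunct2, THEN conjunct1, rule_format]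
    and rep3 = rep[unfolded bar_visibility_rep_def, THEN conjunct2, THEN conjunct2, rule_format]
  have bars: "finite (\<beta> v)" "card (\<beta> v) \<le> t" "\<And>B. B \<in> \<beta> v \<Longrightarrow> is_bar B" if "v \<in> verts G" for v
    using bspec[OF rep1 that] by simp_all
  have disj: "B \<inter> B' = {}" if "u \<in> verts G" "v \<in> verts G" "B \<in> \<beta> u" "B' \<in> \<beta> v" "(u, B) \<noteq> (v, B')" for u v B B'
    by (rule rep2[OF that])
  define \<B> where "\<B> = (\<Union>v\<in>verts G. \<beta> v)"
  have visible: "\<exists>B\<in>\<beta> u. \<exists>B'\<in>\<beta> v. sees \<B> B B'" if "u \<in> U" "v \<in> V" for u v
  proof -
    have "u \<noteq> v" "u \<in> verts G" "v \<in> verts G" "u \<rightarrow>\<^bsub>G\<^esub> v"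
      using that UV(1,2,5) by auto
    then show ?thesis
      using rep3[of u v] unfolding \<B>_def by simp
  qed
  have "\<forall>B. \<exists>l r h. is_bar B \<longrightarrow> l < r \<and> B = {l..r} \<times> {h}"
    unfolding is_bar_def by blast
  then have "\<exists>l r h. \<forall>B. is_bar B \<longrightarrow> l B < r B \<and> B = {l B..r B} \<times> {h B}"
    by (simp only: choice_iff)
  then obtain l r h where "\<forall>B. is_bar B \<longrightarrow> l B < r B \<and> B = {l B..r B} \<times> {h B}"
    by (elim exE)
  then have lr: "l B < r B" and mem_bar: "(x, y) \<in> B \<longleftrightarrow> l B \<le> x \<and> x \<le> r B \<and> y = h B" if "is_bar B" for B x y
    using that by (blast, metis SigmaE2 SigmaI atLeastAtMost_iff singletonD singletonI)
  have owner: "u = v" if "u \<in> verts G" "v \<in> verts G" "B \<in> \<beta> u" "B \<in> \<beta> v" for u v B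
  proof (rule ccontr)
    assume "u \<noteq> v"
    then have "B = {}"
      using disj[OF that] by simp
    then show False
      using lr[OF bars(3)[OF that(1,3)]] mem_bar[OF bars(3)[OF that(1,3)], of "l B" "h B"] by simp
  qed
  define BU where "BU = (\<Union>u\<in>U. \<beta> u)"
  define BV where "BV = (\<Union>v\<in>V. \<beta> v)"
  have finB: "finite BU" "finite BV"
    using fin bars(1) UV(1) by (auto simp: BU_def BV_def)
  have card_le: "card (\<Union>v\<in>W. \<beta> v) \<le> card W * t" if W: "finite W" "W \<subseteq> verts G" for W
  proof -
    have "card (\<Union>v\<in>W. \<beta> v) \<le> (\<Sum>v\<in>W. card (\<beta> v))"
      by (rule card_UN_le[OF W(1)])
    also have "\<dots> \<le> of_nat (card W) * t"
      by (rule sum_bounded_above) (use bars(2) W(2) in blast)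
    finally show ?thesis
      by simp
  qed
  have cardB: "card BU \<le> m * t" "card BV \<le> n * t"
    using card_le[OF fin(1)] card_le[OF fin(2)] UV(1,3,4) by (simp_all add: BU_def BV_def)
  \<comment> \<open>The tags record the side of a bar, as \<open>sweep\<close> reads the side off
    the letter; \<open>un\<close> forgets them.\<close>
  define X :: "((real \<times> real) set + (real \<times> real) set) set" where "X = Inl ` BU \<union> Inr ` BV"
  define un :: "(real \<times> real) set + (real \<times> real) set \<Rightarrow> (real \<times> real) set" where "un = case_sum id id"
  have finX: "finite X"
    using finB by (simp add: X_def)
  have cardX: "card X = card BU + card BV"
    unfolding X_def using finB by (subst card_Un_disjoint) (auto simp: card_image)
  have un_owner: "\<exists>v\<in>verts G. un x \<in> \<beta> v \<and> (v \<in> U \<longleftrightarrow> isl x)" if "x \<in> X" for x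
    using that UV(1,2) by (auto simp: X_def un_def BU_def BV_def)
  have un_bar: "is_bar (un x)" if "x \<in> X" for x
    using un_owner[OF that] bars(3) by blast
  have un_disj: "un x \<inter> un y = {}" if xy: "x \<in> X" "y \<in> X" "x \<noteq> y" for x y
  proof -
    obtain u where u: "u \<in> verts G" "un x \<in> \<beta> u" "u \<in> U \<longleftrightarrow> isl x"
      using un_owner[OF xy(1)] by blast
    obtain v where v: "v \<in> verts G" "un y \<in> \<beta> v" "v \<in> U \<longleftrightarrow> isl y"
      using un_owner[OF xy(2)] by blast
    have "(u, un x) \<noteq> (v, un y)"
      using xy(3) u(3) v(3) by (cases x; cases y) (auto simp: un_def)
    then show ?thesis
      using disj[OF u(1) v(1) u(2) v(2)] by blast
  qed
  define active where "active \<tau> = {x \<in> X. l (un x) < \<tau> \<and> \<tau> \<le> r (un x)}" for \<tau>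
  have "\<exists>S. sweep [] (2 * card X) S \<and> (\<forall>\<tau> u v. Inl u \<in> active \<tau> \<longrightarrow> Inr v \<in> active \<tau> \<longrightarrow>
    (\<forall>z\<in>active \<tau>. \<not> (h (un (Inl u)) < h (un z) \<and> h (un z) < h (un (Inr v))) \<and>
      \<not> (h (un (Inr v)) < h (un z) \<and> h (un z) < h (un (Inl u)))) \<longrightarrow> (u, v) \<in> S)"
    unfolding active_def
  proof (rule sweep_exists[OF finX])
    show "l (un x) < r (un x)" if "x \<in> X" for x
      using lr[OF un_bar[OF that]] .
    fix x y assume xy: "x \<in> X" "y \<in> X" "x \<noteq> y" "h (un x) = h (un y)"
    show "r (un x) < l (un y) \<or> r (un y) < l (un x)"
    proof (rule ccontr)
      assume "\<not> ?thesis"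
      then have "(max (l (un x)) (l (un y)), h (un x)) \<in> un x \<inter> un y"
        using lr[OF un_bar[OF xy(1)]] lr[OF un_bar[OF xy(2)]] xy(4)
        by (simp add: mem_bar[OF un_bar[OF xy(1)]] mem_bar[OF un_bar[OF xy(2)]])
      then show False
        using un_disj[OF xy(1-3)] by blast
    qed
  qed
  then obtain S where S: "sweep [] (2 * card X) S"
    "\<And>\<tau> u v. Inl u \<in> active \<tau> \<Longrightarrow> Inr v \<in> active \<tau> \<Longrightarrow>
      (\<And>z. z \<in> active \<tau> \<Longrightarrow> \<not> (h u < h (un z) \<and> h (un z) < h v) \<and> \<not> (h v < h (un z) \<and> h (un z) < h u)) \<Longrightarrow> (u, v) \<in> S"
    by (auto simp: un_def)
  have un_B: "un z \<in> \<B>" if "z \<in> X" for z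
    using un_owner[OF that] by (auto simp: \<B>_def)
  have channel: "\<exists>\<tau>. x \<in> active \<tau> \<and> y \<in> active \<tau> \<and> (\<forall>z\<in>active \<tau>. \<not> (h (un x) < h (un z) \<and> h (un z) < h (un y))) \<and>
      h (un x) < h (un y)"
    if xy: "x \<in> X" "y \<in> X" "channel \<B> (un x) (un y)" for x y
  proof -
    obtain a b c d where ab: "a < b" "c < d" "{a..b} \<times> {c} \<subseteq> un x" "{a..b} \<times> {d} \<subseteq> un y"
      and clear: "\<forall>B\<in>\<B> - {un x, un y}. ({a<..<b} \<times> {c<..<d}) \<inter> B = {}"
      using xy(3) unfolding channel_def by (elim exE conjE)
    have "(a, c) \<in> un x" "(b, c) \<in> un x" "(a, d) \<in> un y" "(b, d) \<in> un y"
      using ab(1,3,4) by auto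
    then have x: "c = h (un x)" "l (un x) \<le> a" "b \<le> r (un x)" and y: "d = h (un y)" "l (un y) \<le> a" "b \<le> r (un y)"
      using mem_bar[OF un_bar[OF xy(1)]] mem_bar[OF un_bar[OF xy(2)]] by auto
    \<comment> \<open>An inner position of the channel: positive width makes both of its bars active
      there.\<close>
    define \<tau> where "\<tau> = (a + b) / 2"
    have \<tau>: "a < \<tau>" "\<tau> < b"
      using ab(1) by (auto simp: \<tau>_def)
    have "\<not> (h (un x) < h (un z) \<and> h (un z) < h (un y))" if z: "z \<in> active \<tau>" for z
    proof
      assume between: "h (un x) < h (un z) \<and> h (un z) < h (un y)"
      have zX: "z \<in> X" "l (un z) < \<tau>" "\<tau> \<le> r (un z)"
        using z by (auto simp: active_def)
      then have "(\<tau>, h (un z)) \<in> un z"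
        by (simp add: mem_bar[OF un_bar[OF zX(1)]])
      moreover have "(\<tau>, h (un z)) \<in> {a<..<b} \<times> {c<..<d}"
        using \<tau> between x(1) y(1) by simp
      moreover have "un z \<in> \<B> - {un x, un y}"
        using un_B[OF zX(1)] between by auto
      ultimately show False
        using clear by blast
    qed
    then show ?thesis
      using xy(1,2) \<tau> x y ab(2) by (intro exI[of _ \<tau>]) (auto simp: active_def)
  qed
  have seen: "(B, B') \<in> S" if B: "B \<in> BU" "B' \<in> BV" "sees \<B> B B'" for B B'
  proof -
    have X: "Inl B \<in> X" "Inr B' \<in> X"
      using B by (auto simp: X_def)
    have un: "un (Inl B) = B" "un (Inr B') = B'"
      by (simp_all add: un_def)
    from B(3) consider "channel \<B> B B'" | "channel \<B> B' B"
      by (auto simp: sees_def)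
    then show ?thesis
    proof cases
      case 1
      then obtain \<tau> where "Inl B \<in> active \<tau>" "Inr B' \<in> active \<tau>" "h B < h B'"
          "\<And>z. z \<in> active \<tau> \<Longrightarrow> \<not> (h B < h (un z) \<and> h (un z) < h B')"
        using channel[OF X] unfolding un by blast
      then show ?thesis
        by (intro S(2)[of B \<tau> B']) auto
    next
      case 2
      then obtain \<tau> where "Inl B \<in> active \<tau>" "Inr B' \<in> active \<tau>" "h B' < h B"
          "\<And>z. z \<in> active \<tau> \<Longrightarrow> \<not> (h B' < h (un z) \<and> h (un z) < h B)"
        using channel[OF X(2,1)] unfolding un by blast
      then show ?thesis
        by (intro S(2)[of B \<tau> B']) auto
    qed
  qed
  \<comment> \<open>Each vertex has a neighbour and hence a bar of its own, so there are at least
    \<open>m + n >= 3\<close> bars, as \<open>sweep_card\<close> requires.\<close>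
  obtain u0 v0 where uv0: "u0 \<in> U" "v0 \<in> V"
    using UV(3,4) mn(1,2) by (metis card.empty equals0I less_irrefl)
  have ne: "\<exists>B. B \<in> \<beta> v" if "v \<in> verts G" for v
    using that visible[of v v0] visible[of u0 v] uv0 UV(1) by auto
  then obtain b where b: "\<And>v. v \<in> verts G \<Longrightarrow> b v \<in> \<beta> v"
    by metis
  have inj_b: "inj_on b (verts G)"
    using b owner by (metis inj_onI)
  have "card U \<le> card BU" "card V \<le> card BV"
    using b finB UV(1) inj_on_subset[OF inj_b]
    by (auto intro!: card_inj_on_le[of b] simp: BU_def BV_def)
  then have "m + n \<le> card X"
    using UV(3,4) cardX by simp
  moreover have "3 \<le> m + n"
    using mn by (cases "m = 1") auto
  ultimately have X3: "3 \<le> card X"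
    by simp
  have "\<forall>p\<in>U \<times> V. \<exists>q. q \<in> S \<and> fst q \<in> \<beta> (fst p) \<and> snd q \<in> \<beta> (snd p)"
  proof
    fix p assume p: "p \<in> U \<times> V"
    then obtain B B' where B: "B \<in> \<beta> (fst p)" "B' \<in> \<beta> (snd p)" "sees \<B> B B'"
      using visible[of "fst p" "snd p"] by auto
    have "B \<in> BU" "B' \<in> BV"
      using p B(1,2) by (auto simp: BU_def BV_def)
    then show "\<exists>q. q \<in> S \<and> fst q \<in> \<beta> (fst p) \<and> snd q \<in> \<beta> (snd p)"
      using seen[OF _ _ B(3)] B(1,2) \<open>B \<in> BU\<close> \<open>B' \<in> BV\<close> by (intro exI[of _ "(B, B')"]) simp
  qed
  from bchoice[OF this] obtain f where f: "\<forall>p\<in>U \<times> V. f p \<in> S \<and> fst (f p) \<in> \<beta> (fst p) \<and> snd (f p) \<in> \<beta> (snd p)"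
    by blast
  have "inj_on f (U \<times> V)"
  proof (rule inj_onI)
    fix p q assume pq: "p \<in> U \<times> V" "q \<in> U \<times> V" "f p = f q"
    have verts: "fst p \<in> verts G" "snd p \<in> verts G" "fst q \<in> verts G" "snd q \<in> verts G"
      using pq(1,2) unfolding UV(1) mem_Times_iff by simp_all
    have p: "fst (f q) \<in> \<beta> (fst p)" "snd (f q) \<in> \<beta> (snd p)"
      using bspec[OF f pq(1)] by (simp_all add: pq(3))
    have q: "fst (f q) \<in> \<beta> (fst q)" "snd (f q) \<in> \<beta> (snd q)"
      using bspec[OF f pq(2)] by simp_all
    have "fst p = fst q" "snd p = snd q"
      using owner[OF verts(1,3) p(1) q(1)] owner[OF verts(2,4) p(2) q(2)] .
    then show "p = q"
      by (rule prod_eqI)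
  qed
  then have "card (U \<times> V) \<le> card S"
    using f sweep_card(1)[OF S(1) X3] by (intro card_inj_on_le[of f]) auto
  then have "m * n + 4 \<le> 2 * card X"
    using sweep_card(2)[OF S(1) X3] UV(3,4) by (simp add: card_cartesian_product)
  also have "\<dots> \<le> 2 * (m * t + n * t)"
    using cardX cardB by simp
  finally show ?thesis
    by (simp add: algebra_simps)
qed

theorem theorem16:
  fixes m n :: nat and G :: "('a, 'b) pre_digraph"
  assumes "m > 0" and "n > 0" and "odd n"
    and "(m, n) \<noteq> (1, 1)"
    and "complete_bipartite_digraph m n G"
  shows "int (bar_visibility_number G) = \<lceil>(real m * real n + 4) / (2 * real m + 2 * real n)\<rceil>"
proof -
  define c where "c = \<lceil>(real m * real n + 4) / (2 * real m + 2 * real n)\<rceil>"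
  \<comment> \<open>Both bounds are stated by this integer inequality: the value \<open>c\<close>
    satisfies it, and every admissible \<open>t\<close> does.\<close>
  have le_iff: "c \<le> int t \<longleftrightarrow> m * n + 4 \<le> 2 * t * (m + n)" for t
  proof -
    have "c \<le> int t \<longleftrightarrow> (real m * real n + 4) / (2 * real m + 2 * real n) \<le> real t"
      by (simp add: c_def ceiling_le_iff)
    also have "\<dots> \<longleftrightarrow> real m * real n + 4 \<le> real t * (2 * real m + 2 * real n)"
      using assms(1) by (intro divide_le_eq[THEN trans]) simp
    also have "\<dots> \<longleftrightarrow> real (m * n + 4) \<le> real (2 * t * (m + n))"
      by (simp add: algebra_simps)
    finally show ?thesis
      by (simp only: of_nat_le_iff)
  qed
  have "0 \<le> (real m * real n + 4) / (2 * real m + 2 * real n)"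
    by simp
  then have "0 \<le> c"
    unfolding c_def by linarith
  then obtain t where t: "c = int t"
    using nonneg_int_cases by blast
  then have "m * n + 4 \<le> 2 * t * (m + n)"
    using le_iff[of t] by simp
  then have "\<exists>\<beta>. bar_visibility_rep t G \<beta>"
    using drawable_rep drawable_if_edge_bound assms by blast
  moreover have "t \<le> t'" if "\<exists>\<beta>. bar_visibility_rep t' G \<beta>" for t'
    using that rep_bound assms le_iff t by (metis of_nat_le_iff)
  ultimately have "bar_visibility_number G = t"
    unfolding bar_visibility_number_def by (rule Least_equality)
  then show ?thesis
    using t by (simp add: c_def)
qed

end
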